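(* Let $R$ be a skew-invertible Hecke symmetry, let $(\mathcal{D}(R^{-1}),\mathcal{M}(R))$ be the associated quantum double and $\hat L=MD$. Then for every integer $k\ge2$ the following matrix Capelli identity holds in $(\mathrm{Mat}_N)^{\otimes k}$ with entries in the quantum double: $$\hat L_1(\hat L_{\overline2}-\mathcal{P}_2)\cdots(\hat L_{\overline k}-\mathcal{P}_k)=M_{\overline{1\to k}}\,D_{\overline{k\to1}}\Bigl(\prod_{s=1}^kJ_s^{-1}\Bigr),$$ where $\mathcal{P}_r=\dfrac{I_r-J_r^{-1}}{q-q^{-1}}$ for $r\ge2$.
   Context: **Hecke symmetry.** $V$ is a complex vector space of dimension $N$. $I$ is the identity operator on $V$ or the $N\times N$ unit matrix, and $P$ is the flip on $V^{\otimes 2}$. A Hecke symmetry is $R\in\mathrm{End}(V^{\otimes 2})$ satisfying $(R\otimes I)(I\otimes R)(R\otimes I)=(I\otimes R)(R\otimes I)(I\otimes R)$ and $(qI\otimes I-R)(q^{-1}I\otimes I+R)=0$. Here $q\in\mathbb{C}\setminus\{0,\pm1\}$ is generic: $q^n\neq1$ for all positive integers $n$. Standing assumptions: $R$ is skew-invertible, i.e. there is $\Psi\in\mathrm{End}(V^{\otimes2})$ with $\mathrm{Tr}_2R_{12}\Psi_{23}=\mathrm{Tr}_2\Psi_{12}R_{23}=P_{13}$; and $R$ is taken from a family having a limit as $q\to1$ which is an involutive symmetry ($R^2=I\otimes I$ in the limit). **Matrix notation.** $R_i=I^{\otimes(i-1)}\otimes R\otimes I^{\otimes(k-i-1)}$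 acts on $V^{\otimes k}$, with $k$ sufficiently large. For an $N\times N$ matrix $X$ (possibly with noncommuting entries, row index lower and column index upper) put $X_{\overline1}=X_1=X\otimes I^{\otimes(k-1)}$, $X_{\overline{r+1}}=R_rX_{\overline r}R_r^{-1}$, $X_{\overline{1\to n}}=X_{\overline1}X_{\overline2}\cdots X_{\overline n}$, and $X_{\overline{n\to1}}=X_{\overline n}X_{\overline{n-1}}\cdots X_{\overline1}$. $I_r$ denotes the identity matrix in the tensor product. $J_1$ is the identity and $J_r=R_{r-1}J_{r-1}R_{r-1}$ for $r\ge2$ (images of the Jucys-Murphy elements; they commute with each other). **Algebras.** $\mathcal{M}(R)$ is the unital associative algebra generated by the entries of $M=\|m_i^j\|$ with relations $R_1M_1R_1M_1=M_1R_1M_1R_1$. $\mathcal{D}(R^{-1})$ is the unital associative algebra generated by the entries of $D=\|\partial_i^j\|$ with relations $R_1^{-1}D_1R_1^{-1}D_1=D_1R_1^{-1}D_1R_1^{-1}$. The quantum double $(\mathcal{D}(R^{-1}),\mathcal{M}(R))$ is the algebra formed by these two algebras together with the permutation relations $D_1R_1M_1R_1=R_1M_1R_1^{-1}D_1+R_1$. The entries of $\hat L=MD$ are $\hat l_i^j=\sum_km_i^k\partial_k^j$. *)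

theory Defs
  imports
    "Jordan_Normal_Form.Gauss_Jordan_Elimination"
    "HOL-Library.Poly_Mapping"
    "HOL-Algebra.QuotRing"
begin

subsection \<open>Tensor products of matrices\<close>

text \<open>
  A basis of the \<open>k\<close>-fold tensor power of an \<open>N\<close>-dimensional space is indexed by
  \<open>{..<N ^ k}\<close>, the base-\<open>N\<close> digits (most significant first) being the tensor indices.
  Operators are identified with their matrices, row index = lower index.
\<close>

definition kron :: "'a :: times mat \<Rightarrow> 'a mat \<Rightarrow> 'a mat" where
  "kron A B = mat (dim_row A * dim_row B) (dim_col A * dim_col B)
     (\<lambda>(i, j). A $$ (i div dim_row B, j div dim_col B) * B $$ (i mod dim_row B, j mod dim_col B))"

definition flip_mat :: "nat \<Rightarrow> complex mat" where
  "flip_mat N = mat (N ^ 2) (N ^ 2)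
     (\<lambda>(i, j). if i div N = j mod N \<and> i mod N = j div N then 1 else 0)"

text \<open>Partial trace over the middle factor of a threefold tensor product.\<close>

definition tr2 :: "nat \<Rightarrow> complex mat \<Rightarrow> complex mat" where
  "tr2 N X = mat (N ^ 2) (N ^ 2)
     (\<lambda>(i, j). \<Sum>b<N. X $$ ((i div N) * N ^ 2 + b * N + i mod N, (j div N) * N ^ 2 + b * N + j mod N))"

text \<open>Junk unless the argument is an invertible square matrix.\<close>

definition minv :: "complex mat \<Rightarrow> complex mat" where
  "minv A = the (mat_inverse A)"

text \<open>Ordered product of \<open>n \<times> n\<close> matrices.\<close>

definition mprod :: "nat \<Rightarrow> 'a :: semiring_1 mat list \<Rightarrow> 'a mat" where
  "mprod n As = foldr (*) As (1\<^sub>m n)"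

subsection \<open>Hecke symmetries\<close>

definition braid_eq :: "nat \<Rightarrow> complex mat \<Rightarrow> bool" where
  "braid_eq N R \<longleftrightarrow>
     kron R (1\<^sub>m N) * kron (1\<^sub>m N) R * kron R (1\<^sub>m N) =
     kron (1\<^sub>m N) R * kron R (1\<^sub>m N) * kron (1\<^sub>m N) R"

definition hecke_symmetry :: "nat \<Rightarrow> complex \<Rightarrow> complex mat \<Rightarrow> bool" where
  "hecke_symmetry N q R \<longleftrightarrow>
     q \<notin> {0, 1, -1} \<and> R \<in> carrier_mat (N ^ 2) (N ^ 2) \<and> braid_eq N R \<and>
     (q \<cdot>\<^sub>m 1\<^sub>m (N ^ 2) - R) * (inverse q \<cdot>\<^sub>m 1\<^sub>m (N ^ 2) + R) = 0\<^sub>m (N ^ 2) (N ^ 2)"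

definition generic :: "complex \<Rightarrow> bool" where
  "generic q \<longleftrightarrow> (\<forall>n>0. q ^ n \<noteq> 1)"

definition involutive_symmetry :: "nat \<Rightarrow> complex mat \<Rightarrow> bool" where
  "involutive_symmetry N R \<longleftrightarrow>
     R \<in> carrier_mat (N ^ 2) (N ^ 2) \<and> braid_eq N R \<and> R * R = 1\<^sub>m (N ^ 2)"

definition skew_invertible :: "nat \<Rightarrow> complex mat \<Rightarrow> bool" where
  "skew_invertible N R \<longleftrightarrow> (\<exists>\<Psi> \<in> carrier_mat (N ^ 2) (N ^ 2).
     tr2 N (kron R (1\<^sub>m N) * kron (1\<^sub>m N) \<Psi>) = flip_mat N \<and>
     tr2 N (kron \<Psi> (1\<^sub>m N) * kron (1\<^sub>m N) R) = flip_mat N)"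

text \<open>
  \<open>R\<close> is the member at \<open>q\<close> of a family of Hecke symmetries with an involutive limit at \<open>1\<close>.
  Neither the parameter set \<open>S\<close> nor the dependence on the parameter is restricted any further,
  so the condition follows from every more regular notion of family (continuous, analytic, ...).
\<close>

definition in_deformation_family :: "nat \<Rightarrow> complex \<Rightarrow> complex mat \<Rightarrow> bool" where
  "in_deformation_family N q R \<longleftrightarrow>
     (\<exists>S \<R> R0. q \<in> S \<and> \<R> q = R \<and> (\<forall>p\<in>S. hecke_symmetry N p (\<R> p)) \<and>
        \<not> trivial_limit (at 1 within S) \<and> involutive_symmetry N R0 \<and>
        (\<forall>i<N ^ 2. \<forall>j<N ^ 2. ((\<lambda>p. \<R> p $$ (i, j)) \<longlongrightarrow> R0 $$ (i, j)) (at 1 within S)))"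

subsection \<open>The matrices \<open>R\<^sub>i\<close> and the Jucys-Murphy matrices\<close>

definition R_at :: "nat \<Rightarrow> nat \<Rightarrow> complex mat \<Rightarrow> nat \<Rightarrow> complex mat" where
  "R_at N k R i = kron (1\<^sub>m (N ^ (i - 1))) (kron R (1\<^sub>m (N ^ (k - i - 1))))"

text \<open>The clauses for \<open>0\<close> here and in \<open>overl\<close> below are junk: indices start at \<open>1\<close>.\<close>

fun jm :: "nat \<Rightarrow> nat \<Rightarrow> complex mat \<Rightarrow> nat \<Rightarrow> complex mat" where
  "jm N k R 0 = 1\<^sub>m (N ^ k)"
| "jm N k R (Suc 0) = 1\<^sub>m (N ^ k)"
| "jm N k R (Suc (Suc r)) = R_at N k R (Suc r) * jm N k R (Suc r) * R_at N k R (Suc r)"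

definition jm_shift :: "nat \<Rightarrow> nat \<Rightarrow> complex \<Rightarrow> complex mat \<Rightarrow> nat \<Rightarrow> complex mat" where
  "jm_shift N k q R r = (1 / (q - inverse q)) \<cdot>\<^sub>m (1\<^sub>m (N ^ k) - minv (jm N k R r))"

subsection \<open>Free associative algebras\<close>

text \<open>
  Words form a monoid, written additively since \<open>poly_mapping\<close> multiplies by convolution over
  an additive (here noncommutative) monoid of keys; so \<open>'g word \<Rightarrow>\<^sub>0 complex\<close> is the free unital
  associative algebra over \<open>'g\<close>.
\<close>

datatype 'g word = Word (letters: "'g list")

instantiation word :: (type) monoid_add
begin
definition zero_word :: "'a word" where "zero_word = Word []"
definition plus_word :: "'a word \<Rightarrow> 'a word \<Rightarrow> 'a word" where
  "plus_word v w = Word (letters v @ letters w)"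
instance by standard (simp_all add: zero_word_def plus_word_def)
end

datatype gen = GenM nat nat | GenD nat nat

type_synonym falg = "gen word \<Rightarrow>\<^sub>0 complex"

definition scalar :: "complex \<Rightarrow> falg" where
  "scalar c = Poly_Mapping.single 0 c"

definition var :: "gen \<Rightarrow> falg" where
  "var g = Poly_Mapping.single (Word [g]) 1"

definition gens :: "nat \<Rightarrow> gen set" where
  "gens N = {GenM i j | i j. i < N \<and> j < N} \<union> {GenD i j | i j. i < N \<and> j < N}"

definition free_alg :: "nat \<Rightarrow> falg ring" where
  "free_alg N = \<lparr> carrier = {x. \<forall>w \<in> Poly_Mapping.keys x. set (letters w) \<subseteq> gens N},
     mult = (*), one = 1, zero = 0, add = (+) \<rparr>"

subsection \<open>The quantum double\<close>

abbreviation lift :: "complex mat \<Rightarrow> falg mat" where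
  "lift \<equiv> map_mat scalar"

definition Mmat :: "nat \<Rightarrow> falg mat" where
  "Mmat N = mat N N (\<lambda>(i, j). var (GenM i j))"

definition Dmat :: "nat \<Rightarrow> falg mat" where
  "Dmat N = mat N N (\<lambda>(i, j). var (GenD i j))"

definition M_relations :: "nat \<Rightarrow> complex mat \<Rightarrow> falg set" where
  "M_relations N R = (let M1 = kron (Mmat N) (1\<^sub>m N); R1 = lift R in
     elements_mat (R1 * M1 * R1 * M1 - M1 * R1 * M1 * R1))"

definition D_relations :: "nat \<Rightarrow> complex mat \<Rightarrow> falg set" where
  "D_relations N R = (let D1 = kron (Dmat N) (1\<^sub>m N); R1' = lift (minv R) in
     elements_mat (R1' * D1 * R1' * D1 - D1 * R1' * D1 * R1'))"

definition DM_relations :: "nat \<Rightarrow> complex mat \<Rightarrow> falg set" where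
  "DM_relations N R =
    (let M1 = kron (Mmat N) (1\<^sub>m N); D1 = kron (Dmat N) (1\<^sub>m N);
         R1 = lift R; R1' = lift (minv R) in
     elements_mat (D1 * R1 * M1 * R1 - (R1 * M1 * R1' * D1 + R1)))"

definition qd_relations :: "nat \<Rightarrow> complex mat \<Rightarrow> falg set" where
  "qd_relations N R = M_relations N R \<union> D_relations N R \<union> DM_relations N R"

definition qd_ideal :: "nat \<Rightarrow> complex mat \<Rightarrow> falg set" where
  "qd_ideal N R = genideal (free_alg N) (qd_relations N R)"

definition quantum_double :: "nat \<Rightarrow> complex mat \<Rightarrow> falg set ring" where
  "quantum_double N R = free_alg N Quot qd_ideal N R"

text \<open>
  The canonical projection of the free algebra onto the quantum double. It is a homomorphism, so
  matrices over the quantum double can be computed in the free algebra and then projected.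
\<close>

definition qd_proj :: "nat \<Rightarrow> complex mat \<Rightarrow> falg \<Rightarrow> falg set" where
  "qd_proj N R x = qd_ideal N R +>\<^bsub>free_alg N\<^esub> x"

subsection \<open>Matrix copies in the \<open>k\<close>-fold tensor power\<close>

fun overl :: "nat \<Rightarrow> nat \<Rightarrow> complex mat \<Rightarrow> falg mat \<Rightarrow> nat \<Rightarrow> falg mat" where
  "overl N k R X 0 = kron X (1\<^sub>m (N ^ (k - 1)))"
| "overl N k R X (Suc 0) = kron X (1\<^sub>m (N ^ (k - 1)))"
| "overl N k R X (Suc (Suc r)) =
     lift (R_at N k R (Suc r)) * overl N k R X (Suc r) * lift (minv (R_at N k R (Suc r)))"

definition overl_up :: "nat \<Rightarrow> nat \<Rightarrow> complex mat \<Rightarrow> falg mat \<Rightarrow> falg mat" where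
  "overl_up N k R X = mprod (N ^ k) (map (overl N k R X) [1..<Suc k])"

definition overl_down :: "nat \<Rightarrow> nat \<Rightarrow> complex mat \<Rightarrow> falg mat \<Rightarrow> falg mat" where
  "overl_down N k R X = mprod (N ^ k) (map (overl N k R X) (rev [1..<Suc k]))"

definition Lhat :: "nat \<Rightarrow> falg mat" where
  "Lhat N = Mmat N * Dmat N"

subsection \<open>Well-formedness of the presentation\<close>

text \<open>
  \<open>genideal\<close> would be degenerate if \<open>free_alg N\<close> were not a ring or if the relations
  left its carrier.
\<close>

lemma free_alg_simps [simp]:
  "x \<in> carrier (free_alg N) \<longleftrightarrow> (\<forall>w \<in> Poly_Mapping.keys x. set (letters w) \<subseteq> gens N)"
  "x \<otimes>\<^bsub>free_alg N\<^esub> y = x * y" "x \<oplus>\<^bsub>free_alg N\<^esub> y = x + y"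
  "\<one>\<^bsub>free_alg N\<^esub> = 1" "\<zero>\<^bsub>free_alg N\<^esub> = 0"
  by (simp_all add: free_alg_def)

lemma free_alg_closed:
  "0 \<in> carrier (free_alg N)" "1 \<in> carrier (free_alg N)" "scalar c \<in> carrier (free_alg N)"
  "g \<in> gens N \<Longrightarrow> var g \<in> carrier (free_alg N)"
  "x \<in> carrier (free_alg N) \<Longrightarrow> - x \<in> carrier (free_alg N)"
  "x \<in> carrier (free_alg N) \<Longrightarrow> y \<in> carrier (free_alg N) \<Longrightarrow> x + y \<in> carrier (free_alg N)"
  "x \<in> carrier (free_alg N) \<Longrightarrow> y \<in> carrier (free_alg N) \<Longrightarrow> x - y \<in> carrier (free_alg N)"
  "x \<in> carrier (free_alg N) \<Longrightarrow> y \<in> carrier (free_alg N) \<Longrightarrow> x * y \<in> carrier (free_alg N)"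
proof -
  show "0 \<in> carrier (free_alg N)" by simp
  show "1 \<in> carrier (free_alg N)" by (simp add: zero_word_def)
  show "scalar c \<in> carrier (free_alg N)" by (simp add: scalar_def zero_word_def)
  show "g \<in> gens N \<Longrightarrow> var g \<in> carrier (free_alg N)" by (simp add: var_def)
  show "x \<in> carrier (free_alg N) \<Longrightarrow> - x \<in> carrier (free_alg N)" by simp
  show "x \<in> carrier (free_alg N) \<Longrightarrow> y \<in> carrier (free_alg N) \<Longrightarrow> x + y \<in> carrier (free_alg N)"
    using keys_add[of x y] by (simp; blast)
  show "x \<in> carrier (free_alg N) \<Longrightarrow> y \<in> carrier (free_alg N) \<Longrightarrow> x - y \<in> carrier (free_alg N)"
    using keys_diff[of x y] by (simp; blast)
  show "x * y \<in> carrier (free_alg N)" if "x \<in> carrier (free_alg N)" "y \<in> carrier (free_alg N)"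
  proof -
    have "set (letters w) \<subseteq> gens N" if w: "w \<in> Poly_Mapping.keys (x * y)" for w
    proof -
      obtain u v where "w = u + v" "u \<in> Poly_Mapping.keys x" "v \<in> Poly_Mapping.keys y"
        using keys_mult[of x y] w by blast
      with \<open>x \<in> carrier _\<close> \<open>y \<in> carrier _\<close> show ?thesis
        by (simp add: plus_word_def)
    qed
    then show ?thesis by simp
  qed
qed

lemma free_alg_ring: "ring (free_alg N)"
proof (rule ringI)
  show "abelian_group (free_alg N)"
  proof (rule abelian_groupI)
    fix x assume "x \<in> carrier (free_alg N)"
    then show "\<exists>y \<in> carrier (free_alg N). y \<oplus>\<^bsub>free_alg N\<^esub> x = \<zero>\<^bsub>free_alg N\<^esub>"
      by (intro bexI[of _ "- x"] free_alg_closed) simp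
  qed (simp_all only: free_alg_closed free_alg_simps(2-), simp_all add: algebra_simps)
  show "monoid (free_alg N)"
    by (rule monoidI) (simp_all only: free_alg_closed free_alg_simps(2-), simp_all add: algebra_simps)
qed (simp_all add: algebra_simps)

context
  fixes N :: nat
begin

definition closed_mat :: "falg mat \<Rightarrow> bool" where
  "closed_mat A \<longleftrightarrow> (\<forall>i < dim_row A. \<forall>j < dim_col A. A $$ (i, j) \<in> carrier (free_alg N))"

lemma closed_matD:
  "closed_mat A \<Longrightarrow> i < dim_row A \<Longrightarrow> j < dim_col A \<Longrightarrow> A $$ (i, j) \<in> carrier (free_alg N)"
  by (simp add: closed_mat_def del: free_alg_simps)

lemma closed_mat_elements: "closed_mat A \<Longrightarrow> elements_mat A \<subseteq> carrier (free_alg N)"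
  using closed_matD by (auto simp del: free_alg_simps dest!: elements_matD)

lemma closed_mat_mult:
  assumes "closed_mat A" "closed_mat B" "dim_col A = dim_row B"
  shows "closed_mat (A * B)"
  unfolding closed_mat_def
proof (intro allI impI)
  fix i j assume ij: "i < dim_row (A * B)" "j < dim_col (A * B)"
  have sum_closed: "(\<Sum>l\<in>L. f l) \<in> carrier (free_alg N)"
    if "finite L" "\<And>l. l \<in> L \<Longrightarrow> f l \<in> carrier (free_alg N)" for f and L :: "nat set"
    using that
  proof (induction L rule: finite_induct)
    case empty
    show ?case using free_alg_closed(1) by (simp del: free_alg_simps)
  next
    case (insert l L)
    have "f l + sum f L \<in> carrier (free_alg N)"
      by (rule free_alg_closed(6)) (rule insert, simp, rule insert.IH, rule insert, simp)
    then show ?case using insert.hyps by (simp del: free_alg_simps)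
  qed
  have "(\<Sum>l\<in>{0..<dim_row B}. A $$ (i, l) * B $$ (l, j)) \<in> carrier (free_alg N)"
    by (rule sum_closed, simp, rule free_alg_closed(8); rule closed_matD)
       (use ij assms in auto)
  then show "(A * B) $$ (i, j) \<in> carrier (free_alg N)"
    using ij assms(3) by (simp add: scalar_prod_def del: free_alg_simps)
qed

lemma closed_mat_add:
  assumes "closed_mat A" "closed_mat B" "dim_row A = dim_row B" "dim_col A = dim_col B"
  shows "closed_mat (A + B)"
  unfolding closed_mat_def
proof (intro allI impI)
  fix i j assume ij: "i < dim_row (A + B)" "j < dim_col (A + B)"
  have "A $$ (i, j) + B $$ (i, j) \<in> carrier (free_alg N)"
    by (rule free_alg_closed(6); rule closed_matD) (use ij assms in auto)
  then show "(A + B) $$ (i, j) \<in> carrier (free_alg N)"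
    using ij by (simp del: free_alg_simps)
qed

lemma closed_mat_diff:
  assumes "closed_mat A" "closed_mat B" "dim_row A = dim_row B" "dim_col A = dim_col B"
  shows "closed_mat (A - B)"
  unfolding closed_mat_def
proof (intro allI impI)
  fix i j assume ij: "i < dim_row (A - B)" "j < dim_col (A - B)"
  have "A $$ (i, j) - B $$ (i, j) \<in> carrier (free_alg N)"
    by (rule free_alg_closed(7); rule closed_matD) (use ij assms in auto)
  then show "(A - B) $$ (i, j) \<in> carrier (free_alg N)"
    using ij by (simp del: free_alg_simps)
qed

lemma closed_mat_lift: "closed_mat (lift A)"
  using free_alg_closed(3) by (simp add: closed_mat_def del: free_alg_simps)

lemma closed_mat_kron:
  assumes "closed_mat X" "X \<in> carrier_mat N N"
  shows "closed_mat (kron X (1\<^sub>m N))"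
  unfolding closed_mat_def
proof (intro allI impI)
  fix i j assume "i < dim_row (kron X (1\<^sub>m N))" "j < dim_col (kron X (1\<^sub>m N))"
  then have ij: "i < N * N" "j < N * N" using assms(2) by (auto simp: kron_def)
  then have "N > 0" by (cases N) auto
  have "X $$ (i div N, j div N) \<in> carrier (free_alg N)"
    by (rule closed_matD[OF assms(1)]) (use assms(2) ij in \<open>auto simp: less_mult_imp_div_less\<close>)
  moreover have "(1\<^sub>m N $$ (i mod N, j mod N) :: falg) \<in> carrier (free_alg N)"
    using \<open>N > 0\<close> free_alg_closed(1,2) by (simp del: free_alg_simps)
  ultimately have "X $$ (i div N, j div N) * 1\<^sub>m N $$ (i mod N, j mod N) \<in> carrier (free_alg N)"
    by (rule free_alg_closed(8))
  then show "kron X (1\<^sub>m N) $$ (i, j) \<in> carrier (free_alg N)"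
    using assms(2) ij by (simp add: kron_def del: free_alg_simps index_one_mat(1))
qed

lemma closed_mat_gens: "closed_mat (Mmat N)" "closed_mat (Dmat N)"
  unfolding closed_mat_def Mmat_def Dmat_def gens_def
  by (auto simp del: free_alg_simps intro!: free_alg_closed(4) simp: gens_def)

lemma gens_carrier: "Mmat N \<in> carrier_mat N N" "Dmat N \<in> carrier_mat N N"
  by (simp_all add: Mmat_def Dmat_def)

lemma qd_relations_closed:
  assumes "R \<in> carrier_mat (N ^ 2) (N ^ 2)" "minv R \<in> carrier_mat (N ^ 2) (N ^ 2)"
  shows "qd_relations N R \<subseteq> carrier (free_alg N)"
proof -
  have dims: "dim_row R = N * N" "dim_col R = N * N" "dim_row (minv R) = N * N" "dim_col (minv R) = N * N"
    using assms by (auto simp: power2_eq_square)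
  have kd: "dim_row (kron X (1\<^sub>m N)) = N * N" "dim_col (kron X (1\<^sub>m N)) = N * N"
    if "X \<in> carrier_mat N N" for X :: "falg mat" using that by (auto simp: kron_def)
  show ?thesis
    unfolding qd_relations_def M_relations_def D_relations_def DM_relations_def Let_def
    by (intro Un_least closed_mat_elements closed_mat_diff closed_mat_add closed_mat_mult
          closed_mat_lift closed_mat_kron closed_mat_gens gens_carrier)
       (simp_all add: dims kd gens_carrier)
qed

lemma qd_proj_hom:
  assumes "R \<in> carrier_mat (N ^ 2) (N ^ 2)" "minv R \<in> carrier_mat (N ^ 2) (N ^ 2)"
  shows "qd_proj N R \<in> ring_hom (free_alg N) (quantum_double N R)"
proof -
  interpret ring "free_alg N" by (rule free_alg_ring)
  interpret ideal "qd_ideal N R" "free_alg N"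
    unfolding qd_ideal_def by (rule genideal_ideal) (rule qd_relations_closed[OF assms])
  show ?thesis
    using rcos_ring_hom by (simp add: qd_proj_def[abs_def] quantum_double_def)
qed

end

lemma hecke_symmetry_minv:
  assumes "hecke_symmetry N q R"
  shows "minv R \<in> carrier_mat (N ^ 2) (N ^ 2)" "R * minv R = 1\<^sub>m (N ^ 2)" "minv R * R = 1\<^sub>m (N ^ 2)"
proof -
  define n where "n = N ^ 2"
  have R: "R \<in> carrier_mat n n" and q: "q \<noteq> 0"
    and H: "(q \<cdot>\<^sub>m 1\<^sub>m n - R) * (inverse q \<cdot>\<^sub>m 1\<^sub>m n + R) = 0\<^sub>m n n"
    using assms by (auto simp: hecke_symmetry_def n_def)
  define S where "S = R - (q - inverse q) \<cdot>\<^sub>m 1\<^sub>m n"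
  have S: "S \<in> carrier_mat n n" unfolding S_def by (intro minus_carrier_mat smult_carrier_mat one_carrier_mat)
  have S': "S = R + (- (q - inverse q)) \<cdot>\<^sub>m 1\<^sub>m n"
    using R by (intro eq_matI) (auto simp: S_def)
  have RS: "R * S = R * R + (- (q - inverse q)) \<cdot>\<^sub>m R"
    unfolding S' using R by (simp add: mult_add_distrib_mat[of _ n n _ n] mult_smult_distrib[of _ n n _ n])
  have SR: "S * R = R * R + (- (q - inverse q)) \<cdot>\<^sub>m R"
    unfolding S' using R by (simp add: add_mult_distrib_mat[of _ n n _ _ n] mult_smult_assoc_mat[of _ n n _ n])
  have "(q \<cdot>\<^sub>m 1\<^sub>m n - R) * (inverse q \<cdot>\<^sub>m 1\<^sub>m n + R) =
        (q \<cdot>\<^sub>m 1\<^sub>m n) * (inverse q \<cdot>\<^sub>m 1\<^sub>m n + R) - R * (inverse q \<cdot>\<^sub>m 1\<^sub>m n + R)"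
    using R by (intro minus_mult_distrib_mat[of _ n n _ _ n]) auto
  also have "(q \<cdot>\<^sub>m 1\<^sub>m n) * (inverse q \<cdot>\<^sub>m 1\<^sub>m n + R) = q \<cdot>\<^sub>m (inverse q \<cdot>\<^sub>m 1\<^sub>m n + R)"
    using R by (simp add: mult_smult_assoc_mat[of _ n n _ n])
  also have "R * (inverse q \<cdot>\<^sub>m 1\<^sub>m n + R) = inverse q \<cdot>\<^sub>m R + R * R"
    using R by (simp add: mult_add_distrib_mat[of _ n n _ n] mult_smult_distrib[of _ n n _ n])
  finally have E: "q \<cdot>\<^sub>m (inverse q \<cdot>\<^sub>m 1\<^sub>m n + R) - (inverse q \<cdot>\<^sub>m R + R * R) = 0\<^sub>m n n"
    using H by simp
  have ent: "(R * R) $$ (i, j) + (- (q - inverse q)) * R $$ (i, j) = 1\<^sub>m n $$ (i, j)"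
    if "i < n" "j < n" for i j
  proof -
    have "(q \<cdot>\<^sub>m (inverse q \<cdot>\<^sub>m 1\<^sub>m n + R) - (inverse q \<cdot>\<^sub>m R + R * R)) $$ (i, j) = 0"
      unfolding E using that by simp
    then have "q * (inverse q * 1\<^sub>m n $$ (i, j) + R $$ (i, j)) -
        (inverse q * R $$ (i, j) + (R * R) $$ (i, j)) = 0"
      using R that by (simp del: index_mult_mat(1) index_one_mat(1))
    moreover have "q * (inverse q * 1\<^sub>m n $$ (i, j)) = 1\<^sub>m n $$ (i, j)"
      using q by simp
    ultimately show ?thesis by (simp add: algebra_simps del: index_mult_mat(1) index_one_mat(1))
  qed
  have "R * R + (- (q - inverse q)) \<cdot>\<^sub>m R = 1\<^sub>m n"
    by (rule eq_matI) (use ent R in \<open>auto simp del: index_mult_mat(1)\<close>)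
  then have inv: "R * S = 1\<^sub>m n" "S * R = 1\<^sub>m n" using RS SR by simp_all
  then have U: "R \<in> Units (ring_mat TYPE(complex) n ())"
    using R S unfolding Units_def by (auto simp: ring_mat_simps)
  then obtain T where T: "mat_inverse R = Some T"
    using mat_inverse(1)[OF R, of "()"] by (cases "mat_inverse R") auto
  then have "minv R = T" by (simp add: minv_def)
  then show "minv R \<in> carrier_mat (N ^ 2) (N ^ 2)" "R * minv R = 1\<^sub>m (N ^ 2)"
      "minv R * R = 1\<^sub>m (N ^ 2)"
    using mat_inverse(2)[OF R T] unfolding n_def by auto
qed

end

theory Submission
  imports Defs "Jordan_Normal_Form.Determinant"
begin

text \<open>
  Write \<open>D\<^bsub>k\<rightarrow>1\<^esub>\<close> for the product of the overlined copies of \<open>D\<close> in descending order. By induction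
  on \<open>k\<close>, and since \<open>J\<^sub>1, \<dots>, J\<^sub>k\<close> commute with the \<open>(k+1)\<close>-st factor, the identity reduces to
  \<open>D\<^bsub>k\<rightarrow>1\<^esub> (M\<^bsub>k+1\<^esub> D\<^bsub>k+1\<^esub> - P\<^bsub>k+1\<^esub>) = M\<^bsub>k+1\<^esub> D\<^bsub>k+1\<rightarrow>1\<^esub> J\<^bsub>k+1\<^esub>\<^sup>-\<^sup>1\<close>.
  Moving \<open>M\<^bsub>k+1\<^esub>\<close> to the left through \<open>D\<^bsub>k\<rightarrow>1\<^esub>\<close> by the permutation relations yields
  \<open>M\<^bsub>k+1\<^esub> D\<^bsub>k\<rightarrow>1\<^esub> J\<^bsub>k+1\<^esub>\<^sup>-\<^sup>1\<close> and a remainder \<open>E\<^sub>k\<close> given by a recursion. The Hecke relation amounts to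
  the recursion \<open>P\<^bsub>k+1\<^esub> = J\<^sub>k\<^sup>-\<^sup>1 R\<^sub>k\<^sup>-\<^sup>1 + R\<^sub>k P\<^sub>k R\<^sub>k\<^sup>-\<^sup>1\<close>, from which \<open>E\<^sub>k D\<^bsub>k+1\<^esub> = D\<^bsub>k\<rightarrow>1\<^esub> P\<^bsub>k+1\<^esub>\<close>, so
  the remainder cancels against \<open>P\<^bsub>k+1\<^esub>\<close>. What is left is \<open>D\<^bsub>k\<rightarrow>1\<^esub> J\<^bsub>k+1\<^esub>\<^sup>-\<^sup>1 D\<^bsub>k+1\<^esub> = D\<^bsub>k+1\<rightarrow>1\<^esub> J\<^bsub>k+1\<^esub>\<^sup>-\<^sup>1\<close>, which
  follows from the relations among the entries of \<open>D\<close>.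

  These computations use nothing about matrices, so they are carried out in an arbitrary ring and
  applied to the matrices over the free algebra modulo those with all entries in \<open>qd_ideal\<close>.
\<close>

subsection \<open>Commuting elements and braid relations in a ring\<close>

definition (in monoid) commute :: "'a \<Rightarrow> 'a \<Rightarrow> bool" where
  "commute x y \<longleftrightarrow> x \<in> carrier G \<and> y \<in> carrier G \<and> x \<otimes> y = y \<otimes> x"

context monoid
begin

lemma commuteD: "commute x y \<Longrightarrow> x \<otimes> y = y \<otimes> x"
  by (simp add: commute_def)

lemma commute_sym: "commute x y \<Longrightarrow> commute y x"
  by (simp add: commute_def)

lemma commute_one: "x \<in> carrier G \<Longrightarrow> commute x \<one>"
  by (simp add: commute_def)

lemma commute_mult:
  assumes "commute x y" "commute x z"
  shows "commute x (y \<otimes> z)"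
proof -
  have [simp]: "x \<in> carrier G" "y \<in> carrier G" "z \<in> carrier G"
    using assms by (simp_all add: commute_def)
  have "x \<otimes> (y \<otimes> z) = y \<otimes> (x \<otimes> z)"
    using commuteD[OF assms(1)] by (simp flip: m_assoc)
  also have "\<dots> = y \<otimes> z \<otimes> x"
    using commuteD[OF assms(2)] by (simp add: m_assoc)
  finally show ?thesis by (simp add: commute_def)
qed

lemma commute_inverse:
  assumes "commute x y" "z \<in> carrier G" "y \<otimes> z = \<one>" "z \<otimes> y = \<one>"
  shows "commute x z"
proof -
  have [simp]: "x \<in> carrier G" "y \<in> carrier G" "z \<in> carrier G"
    using assms by (simp_all add: commute_def)
  have "x \<otimes> z = z \<otimes> y \<otimes> x \<otimes> z" by (simp add: assms)
  also have "\<dots> = z \<otimes> (y \<otimes> x) \<otimes> z" by (simp add: m_assoc)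
  also have "\<dots> = z \<otimes> (x \<otimes> y) \<otimes> z" using commuteD[OF assms(1)] by simp
  also have "\<dots> = z \<otimes> x" by (simp add: m_assoc assms)
  finally show ?thesis by (simp add: commute_def)
qed

end

lemma (in ring) commute_minus:
  assumes "commute x y" "commute x z"
  shows "commute x (y \<ominus> z)"
  using assms by (simp add: commute_def a_minus_def l_distr r_distr l_minus r_minus)

text \<open>
  Indices are shifted by one: \<open>r i\<close>, \<open>s i\<close>, \<open>x i\<close>, \<open>jinv i\<close> stand for \<open>R\<^bsub>i+1\<^esub>\<close>, its inverse, the \<open>(i+1)\<close>-st
  overlined copy of \<open>X\<close>, and the inverse of \<open>J\<^bsub>i+1\<^esub>\<close>; the number of tensor factors is \<open>n + 1\<close>.
\<close>

locale braid_rep = ring B for B (structure) +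
  fixes n :: nat and r s :: "nat \<Rightarrow> 'a"
  assumes r_closed [simp]: "i < n \<Longrightarrow> r i \<in> carrier B"
    and s_closed [simp]: "i < n \<Longrightarrow> s i \<in> carrier B"
    and rs [simp]: "i < n \<Longrightarrow> r i \<otimes> s i = \<one>"
    and sr [simp]: "i < n \<Longrightarrow> s i \<otimes> r i = \<one>"
    and braid: "Suc i < n \<Longrightarrow> r i \<otimes> r (Suc i) \<otimes> r i = r (Suc i) \<otimes> r i \<otimes> r (Suc i)"
    and far: "Suc i < j \<Longrightarrow> j < n \<Longrightarrow> r i \<otimes> r j = r j \<otimes> r i"
begin

lemma rs_cancel [simp]:
  "i < n \<Longrightarrow> x \<in> carrier B \<Longrightarrow> r i \<otimes> (s i \<otimes> x) = x"
  "i < n \<Longrightarrow> x \<in> carrier B \<Longrightarrow> s i \<otimes> (r i \<otimes> x) = x"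
  using rs[of i] sr[of i] by (metis m_assoc r_closed s_closed l_one)+

lemma commute_rr:
  assumes "Suc i < j \<or> Suc j < i" "i < n" "j < n"
  shows "commute (r i) (r j)"
  using assms far[of i j] far[of j i] by (auto simp: commute_def)

lemma commute_s:
  assumes "commute x (r i)" "i < n"
  shows "commute x (s i)"
  using assms(2) by (intro commute_inverse[OF assms(1)]) auto

lemma commute_s_left:
  assumes "commute (r i) x" "i < n"
  shows "commute (s i) x"
  using commute_s commute_sym assms by blast

lemma commute_rs: "Suc i < j \<or> Suc j < i \<Longrightarrow> i < n \<Longrightarrow> j < n \<Longrightarrow> commute (r i) (s j)"
  using commute_rr commute_s by blast

text \<open>The braid relation sandwiched between two copies of
  \<open>s i \<otimes> s (Suc i)\<close>; after cancellation one \<open>r\<close> survives on each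
  side. It lets a generator pass through the inverse half of a conjugation.\<close>

lemma rrs:
  assumes "Suc i < n"
  shows "r (Suc i) \<otimes> s i \<otimes> s (Suc i) = s i \<otimes> s (Suc i) \<otimes> r i"
proof -
  have i: "i < n" using assms by simp
  have "s i \<otimes> s (Suc i) \<otimes> r i = s i \<otimes> s (Suc i) \<otimes> (r i \<otimes> r (Suc i) \<otimes> r i) \<otimes> s i \<otimes> s (Suc i)"
    using assms i by (simp add: m_assoc)
  also have "\<dots> = r (Suc i) \<otimes> s i \<otimes> s (Suc i)"
    unfolding braid[OF assms] using assms i by (simp add: m_assoc)
  finally show ?thesis by simp
qed

lemma sss:
  assumes "Suc i < n"
  shows "s i \<otimes> s (Suc i) \<otimes> s i = s (Suc i) \<otimes> s i \<otimes> s (Suc i)"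
proof -
  have i: "i < n" using assms by simp
  have "s i \<otimes> s (Suc i) \<otimes> s i = s (Suc i) \<otimes> (r (Suc i) \<otimes> s i \<otimes> s (Suc i)) \<otimes> s i"
    using assms i by (simp add: m_assoc)
  also have "\<dots> = s (Suc i) \<otimes> s i \<otimes> s (Suc i)"
    unfolding rrs[OF assms] using assms i by (simp add: m_assoc)
  finally show ?thesis .
qed

end

section \<open>Overlined copies of a matrix\<close>

locale overlined = braid_rep +
  fixes x :: "nat \<Rightarrow> 'a"
  assumes x_0: "x 0 \<in> carrier B"
    and x_Suc: "i < n \<Longrightarrow> x (Suc i) = r i \<otimes> x i \<otimes> s i"
    and r_x_0: "0 < i \<Longrightarrow> i < n \<Longrightarrow> r i \<otimes> x 0 = x 0 \<otimes> r i"
begin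

lemma x_closed [simp]: "i \<le> n \<Longrightarrow> x i \<in> carrier B"
  by (induction i) (simp_all add: x_0 x_Suc)

text \<open>\<open>x i\<close> is a word in \<open>x 0\<close> and in \<open>r l\<close>,
  \<open>s l\<close> with \<open>l < i\<close>, and \<open>r j\<close> commutes with all of these
  when \<open>i < j\<close>.\<close>

lemma commute_above: "i < j \<Longrightarrow> j < n \<Longrightarrow> commute (r j) (x i)"
proof (induction i)
  case 0
  then show ?case by (simp add: commute_def r_x_0 x_0)
next
  case (Suc i)
  then show ?case
    by (simp add: x_Suc commute_mult commute_rr commute_rs)
qed

text \<open>The critical case is \<open>x (Suc (Suc i))\<close>: the braid relation turns
  \<open>r i\<close> into \<open>r (Suc i)\<close>, which passes \<open>x i\<close>, and
  \<open>rrs\<close> turns it back into \<open>r i\<close>. Larger indices only add conjugations by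
  generators far from \<open>r i\<close>.\<close>

lemma commute_below: "Suc i < j \<Longrightarrow> j \<le> n \<Longrightarrow> commute (r i) (x j)"
proof (induction j)
  case (Suc j)
  show ?case
  proof (cases "Suc i < j")
    case True
    with Suc show ?thesis by (simp add: x_Suc commute_mult commute_rr commute_rs)
  next
    case False
    with Suc.prems have j: "j = Suc i" and i: "i < n" "Suc i < n" by simp_all
    have comm: "r (Suc i) \<otimes> x i = x i \<otimes> r (Suc i)"
      using commute_above[of i "Suc i"] i by (simp add: commute_def)
    have "r i \<otimes> x (Suc j) = (r i \<otimes> r (Suc i) \<otimes> r i) \<otimes> x i \<otimes> s i \<otimes> s (Suc i)"
      using i by (simp add: j x_Suc m_assoc)
    also have "\<dots> = r (Suc i) \<otimes> r i \<otimes> (r (Suc i) \<otimes> x i) \<otimes> s i \<otimes> s (Suc i)"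
      unfolding braid[OF i(2)] using i by (simp add: m_assoc)
    also have "\<dots> = r (Suc i) \<otimes> r i \<otimes> x i \<otimes> (r (Suc i) \<otimes> s i \<otimes> s (Suc i))"
      unfolding comm using i by (simp add: m_assoc)
    also have "\<dots> = x (Suc j) \<otimes> r i"
      unfolding rrs[OF i(2)] using i by (simp add: j x_Suc m_assoc)
    finally show ?thesis using i j by (simp add: commute_def)
  qed
qed simp

text \<open>Conjugation by \<open>r i \<otimes> r (Suc i)\<close> shifts the index of \<open>s\<close> and of every overlined sequence.\<close>

lemma shift_x:
  assumes "Suc i < n"
  shows "x (Suc i) = r i \<otimes> r (Suc i) \<otimes> x i \<otimes> s (Suc i) \<otimes> s i"
    and "x (Suc (Suc i)) = r i \<otimes> r (Suc i) \<otimes> x (Suc i) \<otimes> s (Suc i) \<otimes> s i"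
proof -
  have i: "i < n" using assms by simp
  have "r (Suc i) \<otimes> x i = x i \<otimes> r (Suc i)"
    using commute_above[of i "Suc i"] assms by (simp add: commute_def)
  then have "r i \<otimes> r (Suc i) \<otimes> x i \<otimes> s (Suc i) \<otimes> s i = r i \<otimes> (x i \<otimes> r (Suc i)) \<otimes> s (Suc i) \<otimes> s i"
    using assms i by (simp add: m_assoc)
  then show "x (Suc i) = r i \<otimes> r (Suc i) \<otimes> x i \<otimes> s (Suc i) \<otimes> s i"
    using assms i by (simp add: x_Suc m_assoc)
  have c: "r i \<otimes> x (Suc (Suc i)) = x (Suc (Suc i)) \<otimes> r i"
    using commute_below[of i "Suc (Suc i)"] assms by (simp add: commute_def)
  have "r i \<otimes> r (Suc i) \<otimes> x (Suc i) \<otimes> s (Suc i) \<otimes> s i = r i \<otimes> x (Suc (Suc i)) \<otimes> s i"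
    using assms i by (simp add: x_Suc m_assoc)
  also have "\<dots> = x (Suc (Suc i))"
    unfolding c using assms i by (simp add: m_assoc)
  finally show "x (Suc (Suc i)) = r i \<otimes> r (Suc i) \<otimes> x (Suc i) \<otimes> s (Suc i) \<otimes> s i" by simp
qed

end

context braid_rep
begin

lemma shift_s:
  assumes "Suc i < n"
  shows "s (Suc i) = r i \<otimes> r (Suc i) \<otimes> s i \<otimes> s (Suc i) \<otimes> s i"
proof -
  have i: "i < n" using assms by simp
  have "r i \<otimes> r (Suc i) \<otimes> s i \<otimes> s (Suc i) \<otimes> s i = r i \<otimes> r (Suc i) \<otimes> (s i \<otimes> s (Suc i) \<otimes> s i)"
    using assms i by (simp add: m_assoc)
  also have "\<dots> = s (Suc i)" unfolding sss[OF assms] using assms i by (simp add: m_assoc)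
  finally show ?thesis by simp
qed

section \<open>Inverse Jucys-Murphy elements\<close>

primrec jinv :: "nat \<Rightarrow> 'a" where
  "jinv 0 = \<one>"
| "jinv (Suc i) = s i \<otimes> jinv i \<otimes> s i"

lemma jinv_closed [simp]: "i \<le> n \<Longrightarrow> jinv i \<in> carrier B"
  by (induction i) simp_all

lemma commute_jinv:
  assumes "i \<le> n" "y \<in> carrier B" "\<And>l. l < i \<Longrightarrow> commute y (s l)"
  shows "commute y (jinv i)"
  using assms by (induction i) (simp_all add: commute_one commute_mult)

lemma commute_jinv_above: "i < j \<Longrightarrow> j < n \<Longrightarrow> commute (r j) (jinv i)"
  by (rule commute_jinv) (simp_all add: commute_rs)

text \<open>Same mechanism as in \<open>commute_below\<close>, with \<open>sss\<close> applied on
  both sides of \<open>jinv i\<close>. Together with \<open>commute_jinv\<close> it makes the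
  Jucys-Murphy elements commute with each other.\<close>

lemma commute_jinv_below: "Suc i < j \<Longrightarrow> j \<le> n \<Longrightarrow> commute (s i) (jinv j)"
proof (induction j)
  case (Suc j)
  show ?case
  proof (cases "Suc i < j")
    case True
    with Suc show ?thesis by (simp add: commute_mult commute_s_left[OF commute_rs])
  next
    case False
    with Suc.prems have j: "j = Suc i" and i: "i < n" "Suc i < n" by simp_all
    have "commute (s (Suc i)) (jinv i)"
      using commute_jinv_above[of i "Suc i"] i by (simp add: commute_s_left)
    then have comm: "s (Suc i) \<otimes> jinv i = jinv i \<otimes> s (Suc i)" by (rule commuteD)
    have "s i \<otimes> jinv (Suc j) = (s i \<otimes> s (Suc i) \<otimes> s i) \<otimes> jinv i \<otimes> s i \<otimes> s (Suc i)"
      using i by (simp add: j m_assoc)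
    also have "\<dots> = s (Suc i) \<otimes> s i \<otimes> (s (Suc i) \<otimes> jinv i) \<otimes> s i \<otimes> s (Suc i)"
      unfolding sss[OF i(2)] using i by (simp add: m_assoc)
    also have "\<dots> = s (Suc i) \<otimes> s i \<otimes> jinv i \<otimes> (s (Suc i) \<otimes> s i \<otimes> s (Suc i))"
      unfolding comm using i by (simp add: m_assoc)
    also have "\<dots> = jinv (Suc j) \<otimes> s i"
      unfolding sss[OF i(2), symmetric] using i by (simp add: j m_assoc)
    finally show ?thesis using i j by (simp add: commute_def)
  qed
qed simp

primrec jinv_prod :: "nat \<Rightarrow> 'a" where
  "jinv_prod 0 = \<one>"
| "jinv_prod (Suc i) = jinv_prod i \<otimes> jinv i"

lemma jinv_prod_closed [simp]: "i \<le> Suc n \<Longrightarrow> jinv_prod i \<in> carrier B"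
  by (induction i) simp_all

text \<open>The last factor of \<open>jinv_prod i\<close> is \<open>jinv (i - 1)\<close>, a word in
  the \<open>s l\<close> with \<open>l < i - 1\<close>; hence the bound
  \<open>Suc l < i\<close>.\<close>

lemma commute_jinv_prod:
  assumes "i \<le> Suc n" "y \<in> carrier B" "\<And>l. Suc l < i \<Longrightarrow> commute y (s l)"
  shows "commute y (jinv_prod i)"
  using assms by (induction i) (simp_all add: commute_one commute_mult commute_jinv)

end

subsection \<open>The Capelli identity in a ring\<close>

text \<open>The element \<open>c\<close> plays the role of the scalar \<open>1 / (q - q\<^sup>-\<^sup>1)\<close>.\<close>

locale braided_double = braid_rep B n r s + m: overlined B n r s m + d: overlined B n r s d
  for B (structure) and n r s m d +
  fixes c
  assumes dd_0: "0 < n \<Longrightarrow> d 0 \<otimes> s 0 \<otimes> d 0 \<otimes> r 0 = r 0 \<otimes> d 0 \<otimes> s 0 \<otimes> d 0"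
    and dm_0: "0 < n \<Longrightarrow> d 0 \<otimes> m 1 = m 1 \<otimes> d 0 \<otimes> s 0 \<otimes> s 0 \<oplus> s 0"
    and c_closed [simp]: "c \<in> carrier B"
    and c_r: "i < n \<Longrightarrow> c \<otimes> r i = r i \<otimes> c"
    and hecke: "i < n \<Longrightarrow> c \<otimes> (r i \<ominus> s i) = \<one>"
begin

text \<open>Conjugation by \<open>r i \<otimes> r (Suc i)\<close> takes \<open>d i\<close>,
  \<open>m (Suc i)\<close>, \<open>s i\<close> to \<open>d (Suc i)\<close>,
  \<open>m (Suc (Suc i))\<close>, \<open>s (Suc i)\<close>, so the relation propagates from
  \<open>dm_0\<close>.\<close>

lemma dm: "i < n \<Longrightarrow> d i \<otimes> m (Suc i) = m (Suc i) \<otimes> d i \<otimes> s i \<otimes> s i \<oplus> s i"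
proof (induction i)
  case 0
  then show ?case using dm_0 by simp
next
  case (Suc i)
  then have i: "i < n" by simp
  let ?U = "r i \<otimes> r (Suc i)" and ?V = "s (Suc i) \<otimes> s i"
  have "d (Suc i) \<otimes> m (Suc (Suc i)) = ?U \<otimes> (d i \<otimes> m (Suc i)) \<otimes> ?V"
    unfolding m.shift_x(2)[OF Suc.prems] d.shift_x(1)[OF Suc.prems]
    using Suc.prems i by (simp add: m_assoc)
  also have "\<dots> = ?U \<otimes> (m (Suc i) \<otimes> d i \<otimes> s i \<otimes> s i) \<otimes> ?V \<oplus> ?U \<otimes> s i \<otimes> ?V"
    unfolding Suc.IH[OF i] using Suc.prems i by (simp add: l_distr r_distr)
  also have "?U \<otimes> s i \<otimes> ?V = s (Suc i)"
    by (subst shift_s[OF Suc.prems]) (use Suc.prems i in \<open>simp add: m_assoc\<close>)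
  \<comment> \<open>\<open>?V\<close> is the inverse of \<open>?U\<close>, so
    \<open>?V \<otimes> ?U\<close> may be inserted between the factors.\<close>
  also have "?U \<otimes> (m (Suc i) \<otimes> d i \<otimes> s i \<otimes> s i) \<otimes> ?V =
      (?U \<otimes> m (Suc i) \<otimes> s (Suc i) \<otimes> s i) \<otimes> (?U \<otimes> d i \<otimes> s (Suc i) \<otimes> s i) \<otimes>
      (?U \<otimes> s i \<otimes> s (Suc i) \<otimes> s i) \<otimes> (?U \<otimes> s i \<otimes> s (Suc i) \<otimes> s i)"
    using Suc.prems i by (simp add: m_assoc)
  also have "\<dots> = m (Suc (Suc i)) \<otimes> d (Suc i) \<otimes> s (Suc i) \<otimes> s (Suc i)"
    by (simp only: m.shift_x(2)[OF Suc.prems, symmetric] d.shift_x(1)[OF Suc.prems, symmetric]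
        shift_s[OF Suc.prems, symmetric])
  finally show ?case .
qed

text \<open>First comes a form that involves only \<open>r i\<close>, \<open>s i\<close> and
  \<open>d i\<close>, obtained from \<open>dd_0\<close> by the same shift as in \<open>dm\<close>;
  afterwards \<open>r i \<otimes> d i \<otimes> s i\<close> is read as
  \<open>d (Suc i)\<close>.\<close>

lemma dd: "i < n \<Longrightarrow> d i \<otimes> s i \<otimes> d i = d (Suc i) \<otimes> d i \<otimes> s i"
proof -
  have "i < n \<Longrightarrow> d i \<otimes> s i \<otimes> d i = r i \<otimes> d i \<otimes> s i \<otimes> d i \<otimes> s i"
  proof (induction i)
    case 0
    then have "d 0 \<otimes> s 0 \<otimes> d 0 = (d 0 \<otimes> s 0 \<otimes> d 0 \<otimes> r 0) \<otimes> s 0"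
      by (simp add: m_assoc)
    with 0 show ?case by (simp only: dd_0)
  next
    case (Suc i)
    then have i: "i < n" by simp
    let ?U = "r i \<otimes> r (Suc i)" and ?V = "s (Suc i) \<otimes> s i"
    have r: "?U \<otimes> r i \<otimes> ?V = r (Suc i)"
      unfolding braid[OF Suc.prems] using Suc.prems i by (simp add: m_assoc)
    have s: "?U \<otimes> s i \<otimes> ?V = s (Suc i)"
      by (subst shift_s[OF Suc.prems]) (use Suc.prems i in \<open>simp add: m_assoc\<close>)
    have d: "?U \<otimes> d i \<otimes> ?V = d (Suc i)"
      by (subst d.shift_x(1)[OF Suc.prems]) (use Suc.prems i in \<open>simp add: m_assoc\<close>)
    have "d (Suc i) \<otimes> s (Suc i) \<otimes> d (Suc i) =
        (?U \<otimes> d i \<otimes> ?V) \<otimes> (?U \<otimes> s i \<otimes> ?V) \<otimes> (?U \<otimes> d i \<otimes> ?V)"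
      by (simp only: s d)
    also have "\<dots> = ?U \<otimes> (d i \<otimes> s i \<otimes> d i) \<otimes> ?V"
      using Suc.prems i by (simp add: m_assoc)
    also have "\<dots> = ?U \<otimes> r i \<otimes> ?V \<otimes> (?U \<otimes> d i \<otimes> ?V) \<otimes> (?U \<otimes> s i \<otimes> ?V) \<otimes>
        (?U \<otimes> d i \<otimes> ?V) \<otimes> (?U \<otimes> s i \<otimes> ?V)"
      unfolding Suc.IH[OF i] using Suc.prems i by (simp add: m_assoc)
    finally show ?case unfolding r s d .
  qed
  then show "i < n \<Longrightarrow> d i \<otimes> s i \<otimes> d i = d (Suc i) \<otimes> d i \<otimes> s i"
    by (simp add: d.x_Suc)
qed

section \<open>Moving copies of M through a descending product of copies of D\<close>

primrec up :: "nat \<Rightarrow> 'a" where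
  "up 0 = \<one>"
| "up (Suc i) = up i \<otimes> m i"

primrec down :: "nat \<Rightarrow> 'a" where
  "down 0 = \<one>"
| "down (Suc i) = d i \<otimes> down i"

definition p :: "nat \<Rightarrow> 'a" where
  "p i = c \<otimes> (\<one> \<ominus> jinv i)"

text \<open>Since \<open>jinv 0\<close> is the unit, \<open>p 0\<close> vanishes. The first factor
  is therefore the unshifted \<open>m 0 \<otimes> d 0\<close>, although all factors are written in
  the same form.\<close>

primrec capelli :: "nat \<Rightarrow> 'a" where
  "capelli 0 = \<one>"
| "capelli (Suc i) = capelli i \<otimes> (m i \<otimes> d i \<ominus> p i)"

text \<open>The term \<open>E\<^sub>i\<close> of the overview. The first summand comes from the
  inhomogeneous term \<open>s i\<close> in \<open>dm\<close>; the second is the previous remainder,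
  carried along when \<open>m (Suc i)\<close> is written as a conjugate of
  \<open>m i\<close>.\<close>

primrec remainder :: "nat \<Rightarrow> 'a" where
  "remainder 0 = \<zero>"
| "remainder (Suc i) = down i \<otimes> jinv i \<otimes> s i \<oplus> d i \<otimes> r i \<otimes> remainder i \<otimes> s i"

lemma up_closed [simp]: "i \<le> Suc n \<Longrightarrow> up i \<in> carrier B"
  by (induction i) simp_all

lemma down_closed [simp]: "i \<le> Suc n \<Longrightarrow> down i \<in> carrier B"
  by (induction i) simp_all

lemma p_closed [simp]: "i \<le> n \<Longrightarrow> p i \<in> carrier B"
  by (simp add: p_def)

lemma remainder_closed [simp]: "i \<le> n \<Longrightarrow> remainder i \<in> carrier B"
  by (induction i) simp_all

lemma commute_down: "i \<le> j \<Longrightarrow> j < n \<Longrightarrow> commute (r j) (down i)"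
  by (induction i) (simp_all add: commute_one commute_mult d.commute_above)

text \<open>By \<open>hecke\<close>, multiplying \<open>jinv i \<otimes> s i\<close> by
  \<open>c \<otimes> (r i \<ominus> s i)\<close> changes nothing but turns it into a difference. Its
  term \<open>r i \<otimes> jinv i \<otimes> s i\<close> cancels against the one in the conjugate of
  \<open>p i\<close>, and what remains contains \<open>s i \<otimes> jinv i \<otimes> s i\<close>,
  which is \<open>jinv (Suc i)\<close>.\<close>

lemma p_Suc:
  assumes i: "i < n"
  shows "p (Suc i) = jinv i \<otimes> s i \<oplus> r i \<otimes> p i \<otimes> s i"
proof -
  let ?j = "jinv i"
  have cr: "r i \<otimes> c = c \<otimes> r i" using c_r i by simp
  have "?j \<otimes> s i = c \<otimes> (r i \<ominus> s i) \<otimes> (?j \<otimes> s i)"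
    using i by (simp add: hecke)
  also have "\<dots> = c \<otimes> (r i \<otimes> ?j \<otimes> s i \<ominus> s i \<otimes> ?j \<otimes> s i)"
    using i by (simp add: m_assoc a_minus_def l_distr r_distr l_minus r_minus)
  finally have 1: "?j \<otimes> s i = c \<otimes> (r i \<otimes> ?j \<otimes> s i \<ominus> s i \<otimes> ?j \<otimes> s i)" .
  have "r i \<otimes> p i \<otimes> s i = (r i \<otimes> c) \<otimes> (\<one> \<ominus> ?j) \<otimes> s i"
    using i by (simp add: p_def m_assoc)
  also have "\<dots> = c \<otimes> (\<one> \<ominus> r i \<otimes> ?j \<otimes> s i)"
    unfolding cr using i by (simp add: m_assoc a_minus_def l_distr r_distr l_minus r_minus)
  finally have 2: "r i \<otimes> p i \<otimes> s i = c \<otimes> (\<one> \<ominus> r i \<otimes> ?j \<otimes> s i)" .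
  have "?j \<otimes> s i \<oplus> r i \<otimes> p i \<otimes> s i =
      c \<otimes> ((r i \<otimes> ?j \<otimes> s i \<ominus> s i \<otimes> ?j \<otimes> s i) \<oplus> (\<one> \<ominus> r i \<otimes> ?j \<otimes> s i))"
    unfolding 2 by (subst 1) (use i in \<open>simp add: r_distr\<close>)
  also have "(r i \<otimes> ?j \<otimes> s i \<ominus> s i \<otimes> ?j \<otimes> s i) \<oplus> (\<one> \<ominus> r i \<otimes> ?j \<otimes> s i) = \<one> \<ominus> s i \<otimes> ?j \<otimes> s i"
  proof -
    have "(a \<ominus> b) \<oplus> (e \<ominus> a) = e \<ominus> b"
      if "a \<in> carrier B" "b \<in> carrier B" "e \<in> carrier B" for a b e
      using that by algebra
    then show ?thesis using i by simp
  qed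
  finally show ?thesis by (simp add: p_def)
qed

text \<open>With \<open>d (Suc i)\<close> written as a conjugate, its \<open>r i\<close> cancels the
  last \<open>s i\<close> of \<open>jinv (Suc i)\<close>. The other \<open>s i\<close> passes
  \<open>down i\<close>, the induction hypothesis moves \<open>d i\<close> to the left, and
  \<open>dd\<close> converts \<open>d i \<otimes> s i \<otimes> d i\<close>.\<close>

lemma down_jinv_d: "i \<le> n \<Longrightarrow> down i \<otimes> jinv i \<otimes> d i = d i \<otimes> down i \<otimes> jinv i"
proof (induction i)
  case 0
  then show ?case by simp
next
  case (Suc i)
  then have i: "i < n" "i \<le> n" by simp_all
  have c: "down i \<otimes> s i = s i \<otimes> down i"
    using commute_s_left[OF commute_down[of i i]] i by (simp add: commute_def)
  have "down (Suc i) \<otimes> jinv (Suc i) \<otimes> d (Suc i) = d i \<otimes> (down i \<otimes> s i) \<otimes> jinv i \<otimes> d i \<otimes> s i"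
    using i by (simp add: d.x_Suc m_assoc)
  also have "\<dots> = d i \<otimes> s i \<otimes> (down i \<otimes> jinv i \<otimes> d i) \<otimes> s i"
    unfolding c using i by (simp add: m_assoc)
  also have "\<dots> = (d i \<otimes> s i \<otimes> d i) \<otimes> down i \<otimes> jinv i \<otimes> s i"
    unfolding Suc.IH[OF i(2)] using i by (simp add: m_assoc)
  also have "\<dots> = d (Suc i) \<otimes> d i \<otimes> (s i \<otimes> down i) \<otimes> jinv i \<otimes> s i"
    unfolding dd[OF i(1)] using i Suc.prems by (simp add: m_assoc)
  also have "\<dots> = d (Suc i) \<otimes> down (Suc i) \<otimes> jinv (Suc i)"
    unfolding c[symmetric] using i Suc.prems by (simp add: m_assoc)
  finally show ?case .
qed

text \<open>The two summands of \<open>remainder\<close> match the two summands in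
  \<open>p_Suc\<close>: the first by \<open>down_jinv_d\<close>, the second by the induction
  hypothesis once \<open>r i\<close> has passed \<open>down i\<close>.\<close>

lemma remainder_d: "i \<le> n \<Longrightarrow> remainder i \<otimes> d i = down i \<otimes> p i"
proof (induction i)
  case 0
  have "\<one> \<ominus> \<one> = \<zero>" by (simp only: a_minus_def r_neg one_closed)
  then show ?case by (simp add: p_def)
next
  case (Suc i)
  then have i: "i < n" "i \<le> n" by simp_all
  have c: "r i \<otimes> down i = down i \<otimes> r i"
    using commute_down[of i i] i by (simp add: commute_def)
  have "remainder (Suc i) \<otimes> d (Suc i) =
      (down i \<otimes> jinv i \<otimes> d i) \<otimes> s i \<oplus> d i \<otimes> r i \<otimes> (remainder i \<otimes> d i) \<otimes> s i"
    using i by (simp add: d.x_Suc l_distr m_assoc)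
  also have "\<dots> = d i \<otimes> down i \<otimes> jinv i \<otimes> s i \<oplus> d i \<otimes> (r i \<otimes> down i) \<otimes> p i \<otimes> s i"
    unfolding down_jinv_d[OF i(2)] Suc.IH[OF i(2)] using i by (simp add: m_assoc)
  also have "\<dots> = down (Suc i) \<otimes> p (Suc i)"
    unfolding c p_Suc[OF i(1)] using i by (simp add: m_assoc r_distr)
  finally show ?case .
qed

lemma down_m: "i \<le> n \<Longrightarrow> down i \<otimes> m i = m i \<otimes> down i \<otimes> jinv i \<oplus> remainder i"
proof (induction i)
  case 0
  then show ?case by simp
next
  case (Suc i)
  then have i: "i < n" "i \<le> n" by simp_all
  have c: "down i \<otimes> r i = r i \<otimes> down i" "down i \<otimes> s i = s i \<otimes> down i"
    using commute_down[of i i] commute_s_left[OF commute_down[of i i]] i by (simp_all add: commute_def)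
  have "down (Suc i) \<otimes> m (Suc i) = d i \<otimes> (down i \<otimes> r i) \<otimes> m i \<otimes> s i"
    using i by (simp add: m.x_Suc m_assoc)
  also have "\<dots> = d i \<otimes> r i \<otimes> (down i \<otimes> m i) \<otimes> s i"
    unfolding c using i by (simp add: m_assoc)
  \<comment> \<open>Here \<open>r i \<otimes> m i\<close> is rewritten as
    \<open>m (Suc i) \<otimes> r i\<close>, which makes \<open>dm\<close> applicable.\<close>
  also have "\<dots> = (d i \<otimes> m (Suc i)) \<otimes> r i \<otimes> down i \<otimes> jinv i \<otimes> s i \<oplus> d i \<otimes> r i \<otimes> remainder i \<otimes> s i"
    unfolding Suc.IH[OF i(2)] using i by (simp add: m.x_Suc m_assoc l_distr r_distr)
  \<comment> \<open>The homogeneous term of \<open>dm\<close> ends in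
    \<open>s i \<otimes> s i\<close>: one copy cancels \<open>r i\<close>, the other will pass
    \<open>down i\<close> and complete \<open>jinv (Suc i)\<close>. The inhomogeneous
    \<open>s i\<close> also cancels \<open>r i\<close> and leaves the first summand of
    \<open>remainder (Suc i)\<close>.\<close>
  also have "(d i \<otimes> m (Suc i)) \<otimes> r i \<otimes> down i \<otimes> jinv i \<otimes> s i =
     m (Suc i) \<otimes> d i \<otimes> (s i \<otimes> down i) \<otimes> jinv i \<otimes> s i \<oplus> down i \<otimes> jinv i \<otimes> s i"
    unfolding dm[OF i(1)] using i Suc.prems by (simp add: m_assoc l_distr)
  also have "\<dots> = m (Suc i) \<otimes> down (Suc i) \<otimes> jinv (Suc i) \<oplus> down i \<otimes> jinv i \<otimes> s i"
    unfolding c(2)[symmetric] using i Suc.prems by (simp add: m_assoc)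
  finally show ?case using i Suc.prems by (simp add: a_assoc)
qed

lemma down_factor:
  assumes i: "i \<le> n"
  shows "down i \<otimes> (m i \<otimes> d i \<ominus> p i) = m i \<otimes> down (Suc i) \<otimes> jinv i"
proof -
  have "down i \<otimes> (m i \<otimes> d i \<ominus> p i) = (down i \<otimes> m i) \<otimes> d i \<ominus> down i \<otimes> p i"
    using i by (simp add: m_assoc a_minus_def r_distr r_minus)
  also have "\<dots> = (m i \<otimes> (down i \<otimes> jinv i \<otimes> d i) \<oplus> down i \<otimes> p i) \<ominus> down i \<otimes> p i"
    unfolding down_m[OF i] remainder_d[OF i, symmetric] using i by (simp add: m_assoc l_distr)
  also have "\<dots> = m i \<otimes> (down i \<otimes> jinv i \<otimes> d i)"
    using i by (simp add: a_minus_def a_assoc r_neg)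
  finally show ?thesis unfolding down_jinv_d[OF i] using i by (simp add: m_assoc)
qed

theorem capelli_identity: "i \<le> Suc n \<Longrightarrow> capelli i = up i \<otimes> down i \<otimes> jinv_prod i"
proof (induction i)
  case 0
  then show ?case by simp
next
  case (Suc i)
  then have i: "i \<le> n" by simp
  have sc: "commute (s l) c" if "l < n" for l
    using c_r[OF that] that by (intro commute_s_left) (simp_all add: commute_def)
  \<comment> \<open>\<open>jinv_prod i\<close> is a word in the \<open>s l\<close> with
    \<open>Suc l < i\<close>, which commute with \<open>m i\<close>, \<open>d i\<close>,
    \<open>jinv i\<close> and \<open>c\<close>; thus the new factor can be brought next to
    \<open>down i\<close>.\<close>
  have "commute (m i \<otimes> d i \<ominus> p i) (jinv_prod i)"
  proof (rule commute_jinv_prod)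
    fix l assume l: "Suc l < i"
    then have l': "l < n" using i by simp
    show "commute (m i \<otimes> d i \<ominus> p i) (s l)" unfolding p_def
      using l l' i by (intro commute_sym[OF commute_minus] commute_mult commute_minus)
        (simp_all add: commute_s_left m.commute_below d.commute_below sc commute_one commute_jinv_below)
  qed (use i in simp_all)
  then have c: "jinv_prod i \<otimes> (m i \<otimes> d i \<ominus> p i) = (m i \<otimes> d i \<ominus> p i) \<otimes> jinv_prod i"
    by (simp add: commute_def)
  \<comment> \<open>\<open>down_factor\<close> produces \<open>jinv i\<close> on the left of
    \<open>jinv_prod i\<close>, whereas the recursion of \<open>jinv_prod\<close> has it on the
    right.\<close>
  have "commute (jinv i) (jinv_prod i)"
    using i by (intro commute_jinv_prod) (auto intro: commute_sym commute_jinv_below)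
  then have cj: "jinv i \<otimes> jinv_prod i = jinv_prod i \<otimes> jinv i" by (rule commuteD)
  have "capelli (Suc i) = up i \<otimes> down i \<otimes> (jinv_prod i \<otimes> (m i \<otimes> d i \<ominus> p i))"
    using Suc i by (simp add: m_assoc)
  also have "\<dots> = up i \<otimes> (down i \<otimes> (m i \<otimes> d i \<ominus> p i)) \<otimes> jinv_prod i"
    unfolding c using i by (simp add: m_assoc)
  also have "\<dots> = up (Suc i) \<otimes> down (Suc i) \<otimes> (jinv i \<otimes> jinv_prod i)"
    unfolding down_factor[OF i] using i by (simp add: m_assoc)
  finally show ?case unfolding cj by simp
qed

end

subsection \<open>Kronecker products and matrix inverses\<close>

lemma kron_carrier [simp]:
  "A \<in> carrier_mat a b \<Longrightarrow> B \<in> carrier_mat c d \<Longrightarrow> kron A B \<in> carrier_mat (a * c) (b * d)"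
  by (auto simp: kron_def)

lemma kron_index:
  assumes "A \<in> carrier_mat a b" "B \<in> carrier_mat c d" "i < a * c" "j < b * d"
  shows "kron A B $$ (i, j) = A $$ (i div c, j div d) * B $$ (i mod c, j mod d)"
  using assms by (auto simp: kron_def)

lemma div_mod_less:
  fixes i a c :: nat
  assumes "i < a * c"
  shows "i div c < a" "i mod c < c"
proof -
  show "i div c < a" using assms by (simp add: less_mult_imp_div_less)
  have "0 < c" using assms by (cases c) auto
  then show "i mod c < c" by simp
qed

text \<open>An index of a Kronecker product is a pair of digits; this splits the sum in a matrix
  product accordingly.\<close>

lemma sum_div_mod:
  "(\<Sum>l<b * e. f (l div e) (l mod e)) = (\<Sum>x<b. \<Sum>y<e. f x y)" for b e :: nat
proof -
  have "(\<Sum>x<b. \<Sum>y<e. f x y) = (\<Sum>(x, y)\<in>{..<b} \<times> {..<e}. f x y)"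
    by (simp add: sum.cartesian_product)
  also have "\<dots> = (\<Sum>l<b * e. f (l div e) (l mod e))"
  proof (rule sum.reindex_bij_witness[of _ "\<lambda>l. (l div e, l mod e)" "\<lambda>(x, y). x * e + y"])
    fix z assume "z \<in> {..<b} \<times> {..<e}"
    then obtain x y where z: "z = (x, y)" "x < b" "y < e" by auto
    have "x * e + y < Suc x * e" using z by simp
    also have "\<dots> \<le> b * e" using z by (intro mult_right_mono) auto
    finally show "(case z of (x, y) \<Rightarrow> x * e + y) \<in> {..<b * e}" using z by simp
  qed (auto simp: div_mod_less)
  finally show ?thesis by simp
qed

text \<open>The entries live in a noncommutative algebra, hence the last assumption.\<close>

lemma kron_mult:
  fixes A B C D :: "'a :: semiring_0 mat"
  assumes A: "A \<in> carrier_mat a b" and B: "B \<in> carrier_mat d e"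
    and C: "C \<in> carrier_mat b c" and D: "D \<in> carrier_mat e f"
    and comm: "\<And>i j k l. i < d \<Longrightarrow> j < e \<Longrightarrow> k < b \<Longrightarrow> l < c \<Longrightarrow>
      B $$ (i, j) * C $$ (k, l) = C $$ (k, l) * B $$ (i, j)"
  shows "kron A B * kron C D = kron (A * C) (B * D)"
proof (rule eq_matI)
  fix i j assume "i < dim_row (kron (A * C) (B * D))" "j < dim_col (kron (A * C) (B * D))"
  then have ij: "i < a * d" "j < c * f" using A B C D by (auto simp: kron_def)
  note b = div_mod_less[OF ij(1)] div_mod_less[OF ij(2)]
  let ?i = "i div d" and ?i' = "i mod d" and ?j = "j div f" and ?j' = "j mod f"
  have "(kron A B * kron C D) $$ (i, j) = (\<Sum>l<b * e. kron A B $$ (i, l) * kron C D $$ (l, j))"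
    using ij carrier_matD[OF kron_carrier[OF A B]] carrier_matD[OF kron_carrier[OF C D]]
    by (simp add: scalar_prod_def lessThan_atLeast0)
  also have "\<dots> = (\<Sum>l<b * e. A $$ (?i, l div e) * B $$ (?i', l mod e) *
      (C $$ (l div e, ?j) * D $$ (l mod e, ?j')))"
    using ij by (intro sum.cong refl) (simp add: kron_index[OF A B] kron_index[OF C D])
  also have "\<dots> = (\<Sum>x<b. \<Sum>y<e. A $$ (?i, x) * B $$ (?i', y) * (C $$ (x, ?j) * D $$ (y, ?j')))"
    by (rule sum_div_mod)
  also have "\<dots> = (\<Sum>x<b. \<Sum>y<e. (A $$ (?i, x) * C $$ (x, ?j)) * (B $$ (?i', y) * D $$ (y, ?j')))"
  proof (intro sum.cong refl)
    fix x y assume "x \<in> {..<b}" "y \<in> {..<e}"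
    then have "B $$ (?i', y) * C $$ (x, ?j) = C $$ (x, ?j) * B $$ (?i', y)"
      using b by (intro comm) auto
    then show "A $$ (?i, x) * B $$ (?i', y) * (C $$ (x, ?j) * D $$ (y, ?j')) =
        (A $$ (?i, x) * C $$ (x, ?j)) * (B $$ (?i', y) * D $$ (y, ?j'))"
      by (metis mult.assoc)
  qed
  also have "\<dots> = (\<Sum>x<b. A $$ (?i, x) * C $$ (x, ?j)) * (\<Sum>y<e. B $$ (?i', y) * D $$ (y, ?j'))"
    by (simp add: sum_product)
  also have "\<dots> = (A * C) $$ (?i, ?j) * (B * D) $$ (?i', ?j')"
    using A B C D b by (simp add: scalar_prod_def lessThan_atLeast0)
  also have "\<dots> = kron (A * C) (B * D) $$ (i, j)"
    using A B C D ij by (intro kron_index[symmetric, of _ a c _ d f]) auto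
  finally show "(kron A B * kron C D) $$ (i, j) = kron (A * C) (B * D) $$ (i, j)" .
qed (use A B C D in \<open>auto simp: kron_def\<close>)

lemma kron_assoc:
  fixes A B C :: "'a :: semigroup_mult mat"
  shows "kron (kron A B) C = kron A (kron B C)"
proof (rule eq_matI)
  fix i j assume ij: "i < dim_row (kron A (kron B C))" "j < dim_col (kron A (kron B C))"
  have A: "A \<in> carrier_mat (dim_row A) (dim_col A)" "B \<in> carrier_mat (dim_row B) (dim_col B)"
    "C \<in> carrier_mat (dim_row C) (dim_col C)" by auto
  have *: "x div (b * c) = x div c div b" "x mod (b * c) div c = x div c mod b"
    "x mod (b * c) mod c = x mod c" if "x < a * b * c" for a b c x :: nat
  proof -
    have "0 < c" using that by (cases c) auto
    then show "x mod (b * c) div c = x div c mod b" "x mod (b * c) mod c = x mod c"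
      by (simp_all add: mod_mult2_eq mult.commute[of b c])
    show "x div (b * c) = x div c div b" by (simp add: div_mult2_eq mult.commute[of b c])
  qed
  have ij': "i < dim_row A * dim_row B * dim_row C" "j < dim_col A * dim_col B * dim_col C"
    "i < dim_row A * (dim_row B * dim_row C)" "j < dim_col A * (dim_col B * dim_col C)"
    using ij by (auto simp: kron_def mult.assoc)
  show "kron (kron A B) C $$ (i, j) = kron A (kron B C) $$ (i, j)"
    unfolding kron_index[OF kron_carrier[OF A(1,2)] A(3) ij'(1,2)]
      kron_index[OF A(1) kron_carrier[OF A(2,3)] ij'(3,4)]
      kron_index[OF A(1,2) div_mod_less(1)[OF ij'(1)] div_mod_less(1)[OF ij'(2)]]
      kron_index[OF A(2,3) div_mod_less(2)[OF ij'(3)] div_mod_less(2)[OF ij'(4)]]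
      *[OF ij'(1)] *[OF ij'(2)]
    by (simp add: mult.assoc)
qed (auto simp: kron_def mult.assoc)

lemma kron_one_one [simp]: "kron (1\<^sub>m a) (1\<^sub>m b) = (1\<^sub>m (a * b) :: 'a :: semiring_1 mat)"
proof (rule eq_matI)
  fix i j assume ij: "i < dim_row (1\<^sub>m (a * b) :: 'a mat)" "j < dim_col (1\<^sub>m (a * b) :: 'a mat)"
  then have ij: "i < a * b" "j < a * b" by simp_all
  have "i = j \<longleftrightarrow> i div b = j div b \<and> i mod b = j mod b"
    by (metis div_mult_mod_eq)
  then show "kron (1\<^sub>m a) (1\<^sub>m b) $$ (i, j) = (1\<^sub>m (a * b) :: 'a mat) $$ (i, j)"
    using ij div_mod_less[OF ij(1)] div_mod_less[OF ij(2)]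
    by (auto simp: kron_index[of _ a a _ b b])
qed (auto simp: kron_def)

lemma kron_one_left [simp]: "kron (1\<^sub>m 1) A = (A :: 'a :: semiring_1 mat)"
  by (rule eq_matI) (auto simp: kron_def)

lemma kron_minus_left:
  fixes A B C :: "'a :: ring mat"
  assumes "A \<in> carrier_mat a b" "B \<in> carrier_mat a b"
  shows "kron (A - B) C = kron A C - kron B C"
proof (rule eq_matI)
  fix i j assume "i < dim_row (kron A C - kron B C)" "j < dim_col (kron A C - kron B C)"
  then have "i < a * dim_row C" "j < b * dim_col C" using assms by (auto simp: kron_def)
  then show "kron (A - B) C $$ (i, j) = (kron A C - kron B C) $$ (i, j)"
    using assms div_mod_less[of i a "dim_row C"] div_mod_less[of j b "dim_col C"]
    by (auto simp: kron_def algebra_simps)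
qed (use assms in \<open>auto simp: kron_def\<close>)

lemma kron_plus_left:
  fixes A B C :: "'a :: semiring mat"
  assumes "A \<in> carrier_mat a b" "B \<in> carrier_mat a b"
  shows "kron (A + B) C = kron A C + kron B C"
proof (rule eq_matI)
  fix i j assume "i < dim_row (kron A C + kron B C)" "j < dim_col (kron A C + kron B C)"
  then have "i < a * dim_row C" "j < b * dim_col C" using assms by (auto simp: kron_def)
  then show "kron (A + B) C $$ (i, j) = (kron A C + kron B C) $$ (i, j)"
    using assms div_mod_less[of i a "dim_row C"] div_mod_less[of j b "dim_col C"]
    by (auto simp: kron_def algebra_simps)
qed (use assms in \<open>auto simp: kron_def\<close>)

text \<open>For square complex matrices a right inverse is also a left inverse, so \<open>A\<close>
  is a unit, \<open>mat_inverse A\<close> is not \<open>None\<close>, and \<open>minv A\<close> is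
  not junk; uniqueness of inverses does the rest.\<close>

lemma minv_unique:
  assumes "A \<in> carrier_mat n n" "B \<in> carrier_mat n n" "A * B = 1\<^sub>m n"
  shows "minv A = B"
proof -
  have BA: "B * A = 1\<^sub>m n" using assms by (rule mat_mult_left_right_inverse)
  then have "A \<in> Units (ring_mat TYPE(complex) n ())"
    using assms unfolding Units_def by (auto simp: ring_mat_simps)
  then obtain T where inv: "mat_inverse A = Some T"
    using mat_inverse(1)[OF assms(1), of "()"] by (cases "mat_inverse A") auto
  then have T: "T \<in> carrier_mat n n" "A * T = 1\<^sub>m n"
    using mat_inverse(2)[OF assms(1)] by auto
  have "T = B * A * T"
    using BA T(1) by simp
  also have "\<dots> = B * (A * T)"
    using assms T by (intro assoc_mult_mat)
  finally have "T = B"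
    using assms T by simp
  then show ?thesis using inv by (simp add: minv_def)
qed

section \<open>Ordered products and central scalars\<close>

lemma mprod_carrier [simp]:
  "(\<And>A. A \<in> set As \<Longrightarrow> A \<in> carrier_mat n n) \<Longrightarrow> mprod n As \<in> carrier_mat n n"
  by (induction As) (auto simp: mprod_def intro!: mult_carrier_mat[of _ n n])

lemma mprod_Nil [simp]: "mprod n [] = 1\<^sub>m n"
  by (simp add: mprod_def)

lemma mprod_Cons [simp]: "mprod n (A # As) = A * mprod n As"
  by (simp add: mprod_def)

lemma mprod_append:
  assumes "\<And>A. A \<in> set As \<Longrightarrow> A \<in> carrier_mat n n" "\<And>A. A \<in> set Bs \<Longrightarrow> A \<in> carrier_mat n n"
  shows "mprod n (As @ Bs) = mprod n As * mprod n Bs"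
  using assms
proof (induction As)
  case Nil
  then have "mprod n Bs \<in> carrier_mat n n" by (intro mprod_carrier) auto
  then show ?case by simp
next
  case (Cons A As)
  have "A \<in> carrier_mat n n" "mprod n As \<in> carrier_mat n n" "mprod n Bs \<in> carrier_mat n n"
    using Cons.prems by (auto intro!: mprod_carrier)
  moreover have "mprod n (As @ Bs) = mprod n As * mprod n Bs"
    using Cons by auto
  ultimately show ?case by simp
qed

lemma scalar_hom: "semiring_hom scalar"
  by unfold_locales (simp_all add: scalar_def single_add mult_single)

text \<open>A scalar is a multiple of the empty word, which is neutral for concatenation, so it
  commutes with every monomial.\<close>

lemma scalar_central: "scalar c * x = x * scalar c"
proof (induction x rule: update_induct)
  case (update f k v)
  \<comment> \<open>The key \<open>k\<close> does not occur in \<open>f\<close>, so updating there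
    amounts to adding a monomial.\<close>
  have "Poly_Mapping.update k v f = f + Poly_Mapping.single k v"
    using update by (intro poly_mapping_eqI)
      (auto simp: lookup_update lookup_add lookup_single in_keys_iff when_def)
  with update.IH show ?case
    by (simp add: algebra_simps) (simp add: scalar_def mult_single mult.commute)
qed simp

subsection \<open>Matrices over the quantum double\<close>

text \<open>The type \<open>falg\<close> contains words in generators with arbitrary indices; the
  carrier keeps the entries inside \<open>free_alg N\<close>, the ring in which
  \<open>qd_ideal\<close> is an ideal.\<close>

definition falg_mat_ring :: "nat \<Rightarrow> nat \<Rightarrow> falg mat ring" where
  "falg_mat_ring N n = \<lparr> carrier = {A \<in> carrier_mat n n. closed_mat N A},
     mult = (*), one = 1\<^sub>m n, zero = 0\<^sub>m n n, add = (+) \<rparr>"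

lemma falg_mat_ring_simps [simp]:
  "A \<in> carrier (falg_mat_ring N n) \<longleftrightarrow> A \<in> carrier_mat n n \<and> closed_mat N A"
  "A \<otimes>\<^bsub>falg_mat_ring N n\<^esub> B = A * B" "A \<oplus>\<^bsub>falg_mat_ring N n\<^esub> B = A + B"
  "\<one>\<^bsub>falg_mat_ring N n\<^esub> = 1\<^sub>m n" "\<zero>\<^bsub>falg_mat_ring N n\<^esub> = 0\<^sub>m n n"
  by (simp_all add: falg_mat_ring_def)

lemma closed_mat_one [simp]: "closed_mat N (1\<^sub>m n)"
  using free_alg_closed(1,2) by (simp add: closed_mat_def del: free_alg_simps)

lemma closed_mat_zero [simp]: "closed_mat N (0\<^sub>m m n)"
  using free_alg_closed(1) by (simp add: closed_mat_def del: free_alg_simps)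

lemma closed_mat_uminus [simp]: "closed_mat N A \<Longrightarrow> closed_mat N (- A)"
  using free_alg_closed(5) by (simp add: closed_mat_def del: free_alg_simps)

lemma ring_falg_mat_ring: "ring (falg_mat_ring N n)"
proof (rule ringI)
  show "abelian_group (falg_mat_ring N n)"
  proof (rule abelian_groupI)
    fix A assume "A \<in> carrier (falg_mat_ring N n)"
    then show "\<exists>B\<in>carrier (falg_mat_ring N n). B \<oplus>\<^bsub>falg_mat_ring N n\<^esub> A = \<zero>\<^bsub>falg_mat_ring N n\<^esub>"
      by (intro bexI[of _ "- A"]) (auto intro: uminus_l_inv_mat)
  qed (auto intro: closed_mat_add comm_add_mat assoc_add_mat)
  show "monoid (falg_mat_ring N n)"
    by (rule monoidI) (auto intro: closed_mat_mult assoc_mult_mat)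
qed (auto intro: add_mult_distrib_mat mult_add_distrib_mat)

text \<open>Serves to identify the subtraction of a ring record with the subtraction of the
  underlying type.\<close>

lemma (in ring) minus_unique:
  assumes "z \<oplus> y = x" "y \<in> carrier R" "z \<in> carrier R"
  shows "x \<ominus> y = z"
  unfolding assms(1)[symmetric] using assms(2,3) by (simp add: a_minus_def a_assoc r_neg)

text \<open>The quantum double is a ring record of cosets, whereas matrix products are formed over a
  type. Matrices over the quotient are therefore represented by the quotient of the matrix ring by
  this ideal.\<close>

definition ideal_mats :: "nat \<Rightarrow> complex mat \<Rightarrow> nat \<Rightarrow> falg mat set" where
  "ideal_mats N R n = {A \<in> carrier_mat n n. \<forall>i<n. \<forall>j<n. A $$ (i, j) \<in> qd_ideal N R}"

lemma ideal_mats_iff: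
  "A \<in> ideal_mats N R n \<longleftrightarrow> A \<in> carrier_mat n n \<and> (\<forall>i<n. \<forall>j<n. A $$ (i, j) \<in> qd_ideal N R)"
  by (simp add: ideal_mats_def)

locale hecke_data =
  fixes N :: nat and q :: complex and R :: "complex mat"
  assumes hecke_symmetry: "hecke_symmetry N q R"
begin

lemma R_carrier [simp]: "R \<in> carrier_mat (N ^ 2) (N ^ 2)"
  using hecke_symmetry by (simp add: hecke_symmetry_def)

lemmas minv_R = hecke_symmetry_minv[OF hecke_symmetry]

sublocale free: ring "free_alg N"
  by (rule free_alg_ring)

sublocale I: ideal "qd_ideal N R" "free_alg N"
  unfolding qd_ideal_def
  by (rule free.genideal_ideal, rule qd_relations_closed) (simp_all add: minv_R)

lemma relations_in_ideal: "qd_relations N R \<subseteq> qd_ideal N R"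
  unfolding qd_ideal_def
  by (rule free.genideal_self, rule qd_relations_closed) (simp_all add: minv_R)

lemma minus_free: "x \<in> carrier (free_alg N) \<Longrightarrow> y \<in> carrier (free_alg N) \<Longrightarrow> x \<ominus>\<^bsub>free_alg N\<^esub> y = x - y"
  by (rule free.minus_unique) (simp_all only: free_alg_closed(7) free_alg_simps(3) diff_add_cancel)

lemma ideal_closed:
  "0 \<in> qd_ideal N R"
  "x \<in> qd_ideal N R \<Longrightarrow> y \<in> qd_ideal N R \<Longrightarrow> x + y \<in> qd_ideal N R"
  "x \<in> qd_ideal N R \<Longrightarrow> - x \<in> qd_ideal N R"
  "x \<in> qd_ideal N R \<Longrightarrow> y \<in> carrier (free_alg N) \<Longrightarrow> x * y \<in> qd_ideal N R"
  "x \<in> qd_ideal N R \<Longrightarrow> y \<in> carrier (free_alg N) \<Longrightarrow> y * x \<in> qd_ideal N R"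
proof -
  show "0 \<in> qd_ideal N R"
    using I.zero_closed by (simp del: free_alg_simps(1))
  show "x + y \<in> qd_ideal N R" if "x \<in> qd_ideal N R" "y \<in> qd_ideal N R"
    using I.a_closed[OF that] by (simp del: free_alg_simps(1))
  show "- x \<in> qd_ideal N R" if x: "x \<in> qd_ideal N R"
  proof -
    have "x \<in> carrier (free_alg N)" using x by (rule I.Icarr)
    then have "\<ominus>\<^bsub>free_alg N\<^esub> x = - x"
      by (intro free.minus_equality) (simp_all only: free_alg_closed free_alg_simps(2-), simp)
    then show ?thesis using I.a_inv_closed[OF x] by simp
  qed
  show "x * y \<in> qd_ideal N R" "y * x \<in> qd_ideal N R" if "x \<in> qd_ideal N R" "y \<in> carrier (free_alg N)"
    using I.I_r_closed[OF that] I.I_l_closed[OF that] by (simp_all del: free_alg_simps(1))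
qed

lemma ideal_sum: "(\<And>i. i \<in> S \<Longrightarrow> f i \<in> qd_ideal N R) \<Longrightarrow> sum f S \<in> qd_ideal N R"
  by (induction S rule: infinite_finite_induct) (simp_all add: ideal_closed(1,2))

lemma qd_proj_eq_iff:
  assumes "x \<in> carrier (free_alg N)" "y \<in> carrier (free_alg N)"
  shows "qd_proj N R x = qd_proj N R y \<longleftrightarrow> x - y \<in> qd_ideal N R"
  unfolding qd_proj_def
  using free.quotient_eq_iff_same_a_r_cos[OF I.ideal_axioms assms]
  unfolding minus_free[OF assms] by (rule sym)

lemma ideal_mats_ideal: "ideal (ideal_mats N R n) (falg_mat_ring N n)"
proof (rule idealI[OF ring_falg_mat_ring])
  interpret ring "falg_mat_ring N n" by (rule ring_falg_mat_ring)
  have closed: "closed_mat N A" if "A \<in> ideal_mats N R n" for A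
    using that I.Icarr by (auto simp: closed_mat_def ideal_mats_iff simp del: free_alg_simps)
  have inv: "\<ominus>\<^bsub>falg_mat_ring N n\<^esub> A = - A" if "A \<in> carrier (falg_mat_ring N n)" for A
    using that by (intro minus_equality) (auto intro: uminus_l_inv_mat)
  show "subgroup (ideal_mats N R n) (add_monoid (falg_mat_ring N n))"
  proof (rule add.subgroupI)
    show "ideal_mats N R n \<subseteq> carrier (falg_mat_ring N n)"
      using closed by (auto simp: ideal_mats_iff)
    have "0\<^sub>m n n \<in> ideal_mats N R n" by (simp add: ideal_mats_iff ideal_closed(1))
    then show "ideal_mats N R n \<noteq> {}" by blast
    show "\<ominus>\<^bsub>falg_mat_ring N n\<^esub> A \<in> ideal_mats N R n" if "A \<in> ideal_mats N R n" for A
    proof -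
      have "A \<in> carrier (falg_mat_ring N n)" using that closed by (auto simp: ideal_mats_iff)
      then have "\<ominus>\<^bsub>falg_mat_ring N n\<^esub> A = - A" by (rule inv)
      then show ?thesis using that by (auto simp: ideal_mats_iff ideal_closed(3))
    qed
    show "A \<oplus>\<^bsub>falg_mat_ring N n\<^esub> B \<in> ideal_mats N R n"
      if "A \<in> ideal_mats N R n" "B \<in> ideal_mats N R n" for A B
      using that by (auto simp: ideal_mats_iff ideal_closed(2))
  qed
  show "B \<otimes>\<^bsub>falg_mat_ring N n\<^esub> A \<in> ideal_mats N R n" "A \<otimes>\<^bsub>falg_mat_ring N n\<^esub> B \<in> ideal_mats N R n"
    if A: "A \<in> ideal_mats N R n" and B: "B \<in> carrier (falg_mat_ring N n)" for A B
  proof -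
    have ent: "A $$ (i, j) \<in> qd_ideal N R" "B $$ (i, j) \<in> carrier (free_alg N)" if "i < n" "j < n" for i j
    proof -
      show "A $$ (i, j) \<in> qd_ideal N R" using A that by (simp only: ideal_mats_iff)
      show "B $$ (i, j) \<in> carrier (free_alg N)"
        by (rule closed_matD) (use B that in auto)
    qed
    have sums: "(\<Sum>l\<in>{0..<n}. B $$ (i, l) * A $$ (l, j)) \<in> qd_ideal N R"
      "(\<Sum>l\<in>{0..<n}. A $$ (i, l) * B $$ (l, j)) \<in> qd_ideal N R" if ij: "i < n" "j < n" for i j
    proof -
      show "(\<Sum>l\<in>{0..<n}. B $$ (i, l) * A $$ (l, j)) \<in> qd_ideal N R"
        using ij by (intro ideal_sum ideal_closed(5)[OF ent(1) ent(2)]) simp_all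
      show "(\<Sum>l\<in>{0..<n}. A $$ (i, l) * B $$ (l, j)) \<in> qd_ideal N R"
        using ij by (intro ideal_sum ideal_closed(4)[OF ent(1) ent(2)]) simp_all
    qed
    show "B \<otimes>\<^bsub>falg_mat_ring N n\<^esub> A \<in> ideal_mats N R n" "A \<otimes>\<^bsub>falg_mat_ring N n\<^esub> B \<in> ideal_mats N R n"
      using A B by (auto simp: ideal_mats_iff scalar_prod_def sums)
  qed
qed

definition Q :: "nat \<Rightarrow> falg mat set ring" where
  "Q n = falg_mat_ring N n Quot ideal_mats N R n"

definition \<phi> :: "nat \<Rightarrow> falg mat \<Rightarrow> falg mat set" where
  "\<phi> n A = ideal_mats N R n +>\<^bsub>falg_mat_ring N n\<^esub> A"

lemma \<phi>_hom: "ring_hom_ring (falg_mat_ring N n) (Q n) (\<phi> n)"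
proof -
  interpret ideal "ideal_mats N R n" "falg_mat_ring N n" by (rule ideal_mats_ideal)
  show ?thesis
    using rcos_ring_hom_ring by (simp add: Q_def \<phi>_def[abs_def])
qed

lemma minus_falg_mat:
  assumes "A \<in> carrier (falg_mat_ring N n)" "B \<in> carrier (falg_mat_ring N n)"
  shows "A \<ominus>\<^bsub>falg_mat_ring N n\<^esub> B = A - B"
proof -
  interpret ring "falg_mat_ring N n" by (rule ring_falg_mat_ring)
  have "A - B + B = A" using assms by auto
  then show ?thesis using assms by (intro minus_unique) (auto intro: closed_mat_diff)
qed

lemma \<phi>_eq_iff:
  assumes "A \<in> carrier (falg_mat_ring N n)" "B \<in> carrier (falg_mat_ring N n)"
  shows "\<phi> n A = \<phi> n B \<longleftrightarrow> A - B \<in> ideal_mats N R n"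
proof -
  interpret ring "falg_mat_ring N n" by (rule ring_falg_mat_ring)
  show ?thesis
    unfolding \<phi>_def
    using quotient_eq_iff_same_a_r_cos[OF ideal_mats_ideal assms]
    unfolding minus_falg_mat[OF assms] by (rule sym)
qed

text \<open>The way back from the quotient of the matrix ring to matrices over the quantum double:
  either side means that all entries of \<open>A - B\<close> lie in
  \<open>qd_ideal N R\<close>.\<close>

lemma \<phi>_eq_iff_qd_proj:
  assumes "A \<in> carrier (falg_mat_ring N n)" "B \<in> carrier (falg_mat_ring N n)"
  shows "\<phi> n A = \<phi> n B \<longleftrightarrow> map_mat (qd_proj N R) A = map_mat (qd_proj N R) B"
proof -
  have "\<phi> n A = \<phi> n B \<longleftrightarrow> (\<forall>i<n. \<forall>j<n. A $$ (i, j) - B $$ (i, j) \<in> qd_ideal N R)"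
    unfolding \<phi>_eq_iff[OF assms] ideal_mats_iff using assms by auto
  also have "\<dots> \<longleftrightarrow> (\<forall>i<n. \<forall>j<n. qd_proj N R (A $$ (i, j)) = qd_proj N R (B $$ (i, j)))"
  proof -
    have "A $$ (i, j) \<in> carrier (free_alg N)" "B $$ (i, j) \<in> carrier (free_alg N)"
      if "i < n" "j < n" for i j
      by (rule closed_matD; use assms that in auto)+
    then show ?thesis by (simp add: qd_proj_eq_iff del: free_alg_simps)
  qed
  also have "\<dots> \<longleftrightarrow> map_mat (qd_proj N R) A = map_mat (qd_proj N R) B"
    using assms by (auto simp: mat_eq_iff)
  finally show ?thesis .
qed

end

lemmas lift_one = semiring_hom.mat_hom_one[OF scalar_hom]
  and lift_mult = semiring_hom.mat_hom_mult[OF scalar_hom]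

lemma lift_minus:
  assumes "A \<in> carrier_mat n m" "B \<in> carrier_mat n m"
  shows "lift (A - B) = lift A - lift B"
  using assms by (intro eq_matI) (auto simp: scalar_def single_diff)

lemma lift_kron: "lift (kron A B) = kron (lift A) (lift B)"
proof (rule eq_matI)
  fix i j assume "i < dim_row (kron (lift A) (lift B))" "j < dim_col (kron (lift A) (lift B))"
  then have ij: "i < dim_row A * dim_row B" "j < dim_col A * dim_col B" by (auto simp: kron_def)
  then show "lift (kron A B) $$ (i, j) = kron (lift A) (lift B) $$ (i, j)"
    using div_mod_less[OF ij(1)] div_mod_less[OF ij(2)]
    by (simp add: kron_def scalar_def mult_single)
qed (auto simp: kron_def)

lemma kron_mult_one:
  fixes A B :: "'a :: semiring_1 mat"
  assumes "A \<in> carrier_mat n n" "B \<in> carrier_mat n n"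
  shows "kron A (1\<^sub>m m) * kron B (1\<^sub>m m) = kron (A * B) (1\<^sub>m m)"
  using kron_mult[OF assms(1) one_carrier_mat assms(2) one_carrier_mat, of m] by auto

lemma kron_one_mult:
  fixes A B :: "'a :: semiring_1 mat"
  assumes "A \<in> carrier_mat n n" "B \<in> carrier_mat n n"
  shows "kron (1\<^sub>m m) A * kron (1\<^sub>m m) B = kron (1\<^sub>m m) (A * B)"
  using kron_mult[OF one_carrier_mat assms(1) one_carrier_mat assms(2), of m] by auto

text \<open>Both products equal \<open>kron A B\<close>. In the second one the entries of
  \<open>B\<close> stand before those of \<open>A\<close>, which is where \<open>comm\<close>
  enters.\<close>

lemma kron_interchange:
  fixes A B :: "'a :: semiring_1 mat"
  assumes A: "A \<in> carrier_mat a a" and B: "B \<in> carrier_mat b b"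
    and comm: "\<And>i j k l. i < b \<Longrightarrow> j < b \<Longrightarrow> k < a \<Longrightarrow> l < a \<Longrightarrow>
      B $$ (i, j) * A $$ (k, l) = A $$ (k, l) * B $$ (i, j)"
  shows "kron A (1\<^sub>m b) * kron (1\<^sub>m a) B = kron (1\<^sub>m a) B * kron A (1\<^sub>m b)"
proof -
  have "kron A (1\<^sub>m b) * kron (1\<^sub>m a) B = kron (A * 1\<^sub>m a) (1\<^sub>m b * B)"
    by (rule kron_mult[OF A one_carrier_mat one_carrier_mat B]) auto
  also have "\<dots> = kron (1\<^sub>m a * A) (B * 1\<^sub>m b)"
    using A B by (simp only: left_mult_one_mat right_mult_one_mat)
  also have "\<dots> = kron (1\<^sub>m a) B * kron A (1\<^sub>m b)"
    by (rule kron_mult[OF one_carrier_mat B A one_carrier_mat comm, symmetric])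
  finally show ?thesis .
qed

subsection \<open>The action of the braid group on a tensor power\<close>

lemma pow_split: "1 \<le> i \<Longrightarrow> i < k \<Longrightarrow> N ^ (i - 1) * (N ^ 2 * N ^ (k - i - 1)) = (N ^ k :: nat)"
  unfolding power_add[symmetric] by (rule arg_cong[of _ _ "power N"]) simp

lemma R_at_carrier [simp]:
  assumes "X \<in> carrier_mat (N ^ 2) (N ^ 2)" "1 \<le> i" "i < k"
  shows "R_at N k X i \<in> carrier_mat (N ^ k) (N ^ k)"
proof -
  have "R_at N k X i \<in> carrier_mat (N ^ (i - 1) * (N ^ 2 * N ^ (k - i - 1))) (N ^ (i - 1) * (N ^ 2 * N ^ (k - i - 1)))"
    unfolding R_at_def using assms(1) by (intro kron_carrier one_carrier_mat)
  then show ?thesis by (simp only: pow_split[OF assms(2,3)])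
qed

lemma R_at_mult:
  assumes "X \<in> carrier_mat (N ^ 2) (N ^ 2)" "Y \<in> carrier_mat (N ^ 2) (N ^ 2)"
  shows "R_at N k X i * R_at N k Y i = R_at N k (X * Y) i"
  unfolding R_at_def using assms
  by (simp only: kron_one_mult[OF kron_carrier[OF assms(1) one_carrier_mat] kron_carrier[OF assms(2) one_carrier_mat]]
      kron_mult_one)

lemma R_at_one:
  assumes "1 \<le> i" "i < k"
  shows "R_at N k (1\<^sub>m (N ^ 2)) i = 1\<^sub>m (N ^ k)"
  unfolding R_at_def by (simp only: kron_one_one pow_split[OF assms])

text \<open>The two generators occurring in a braid relation act on a common threefold tensor product.\<close>

lemma R_at_left:
  assumes "1 \<le> i" "Suc i < k"
  shows "R_at N k X i = kron (1\<^sub>m (N ^ (i - 1))) (kron (kron X (1\<^sub>m N)) (1\<^sub>m (N ^ (k - i - 2))))"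
proof -
  have "k - i - 1 = Suc (k - i - 2)" using assms by simp
  then have "1\<^sub>m (N ^ (k - i - 1)) = (kron (1\<^sub>m N) (1\<^sub>m (N ^ (k - i - 2))) :: complex mat)"
    by simp
  then show ?thesis unfolding R_at_def kron_assoc by (simp only:)
qed

lemma R_at_right:
  assumes "1 \<le> i" "Suc i < k"
  shows "R_at N k X (Suc i) = kron (1\<^sub>m (N ^ (i - 1))) (kron (kron (1\<^sub>m N) X) (1\<^sub>m (N ^ (k - i - 2))))"
proof -
  have "N ^ (Suc i - 1) = N ^ (i - 1) * N" using assms by (cases i) auto
  then have "1\<^sub>m (N ^ (Suc i - 1)) = (kron (1\<^sub>m (N ^ (i - 1))) (1\<^sub>m N) :: complex mat)"
    by simp
  moreover have "k - Suc i - 1 = k - i - 2" by simp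
  ultimately show ?thesis unfolding R_at_def by (simp only: kron_assoc)
qed

text \<open>Prepares \<open>kron_interchange\<close>: an operator on the first \<open>i\<close>
  factors is to be commuted with one that is the identity there.\<close>

lemma R_at_split:
  assumes "X \<in> carrier_mat (N ^ 2) (N ^ 2)" "1 \<le> i" "i < j" "j < k"
  obtains W where "W \<in> carrier_mat (N ^ (k - i)) (N ^ (k - i))" "R_at N k X j = kron (1\<^sub>m (N ^ i)) W"
proof
  let ?W = "kron (1\<^sub>m (N ^ (j - i - 1))) (kron X (1\<^sub>m (N ^ (k - j - 1))))"
  have "N ^ (k - i) = N ^ (j - i - 1) * (N ^ 2 * N ^ (k - j - 1))"
    unfolding power_add[symmetric] by (rule arg_cong[of _ _ "power N"]) (use assms in simp)
  then show "?W \<in> carrier_mat (N ^ (k - i)) (N ^ (k - i))"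
    using assms(1) by (simp only:) (intro kron_carrier one_carrier_mat)
  have "N ^ (j - 1) = N ^ i * N ^ (j - i - 1)"
    unfolding power_add[symmetric] by (rule arg_cong[of _ _ "power N"]) (use assms in simp)
  then show "R_at N k X j = kron (1\<^sub>m (N ^ i)) ?W"
    unfolding R_at_def by (simp only: kron_assoc[symmetric] kron_one_one)
qed

text \<open>The first operator lives on the first \<open>Suc i\<close> factors, the second on the
  remaining ones.\<close>

lemma R_at_far:
  assumes X: "X \<in> carrier_mat (N ^ 2) (N ^ 2)" and ij: "1 \<le> i" "Suc i < j" "j < k"
  shows "R_at N k X i * R_at N k X j = R_at N k X j * R_at N k X i"
proof -
  obtain W where W: "W \<in> carrier_mat (N ^ (k - Suc i)) (N ^ (k - Suc i))"
      "R_at N k X j = kron (1\<^sub>m (N ^ Suc i)) W"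
    using R_at_split[OF X _ ij(2,3)] by auto
  have "N ^ Suc i = N ^ (i - 1) * N ^ 2"
    unfolding power_add[symmetric] by (rule arg_cong[of _ _ "power N"]) (use ij in simp)
  then have V: "kron (1\<^sub>m (N ^ (i - 1))) X \<in> carrier_mat (N ^ Suc i) (N ^ Suc i)"
    using X by (simp only:) (intro kron_carrier one_carrier_mat)
  have "R_at N k X i = kron (kron (1\<^sub>m (N ^ (i - 1))) X) (1\<^sub>m (N ^ (k - Suc i)))"
    unfolding R_at_def kron_assoc by simp
  with kron_interchange[OF V W(1) mult.commute] W(2) show ?thesis by (simp only:)
qed

lemma closed_mat_kron_one:
  assumes "closed_mat N X"
  shows "closed_mat N (kron X (1\<^sub>m e))"
  unfolding closed_mat_def
proof (intro allI impI)
  fix i j assume "i < dim_row (kron X (1\<^sub>m e))" "j < dim_col (kron X (1\<^sub>m e))"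
  then have ij: "i < dim_row X * e" "j < dim_col X * e" by (auto simp: kron_def)
  have "X $$ (i div e, j div e) \<in> carrier (free_alg N)"
    using div_mod_less(1)[OF ij(1)] div_mod_less(1)[OF ij(2)] by (rule closed_matD[OF assms])
  moreover have "(1\<^sub>m e $$ (i mod e, j mod e) :: falg) \<in> carrier (free_alg N)"
    using div_mod_less(2)[OF ij(1)] div_mod_less(2)[OF ij(2)] free_alg_closed(1,2)
    by (simp del: free_alg_simps)
  ultimately have "X $$ (i div e, j div e) * 1\<^sub>m e $$ (i mod e, j mod e) \<in> carrier (free_alg N)"
    by (rule free_alg_closed(8))
  then show "kron X (1\<^sub>m e) $$ (i, j) \<in> carrier (free_alg N)"
    using ij by (simp add: kron_def del: free_alg_simps index_one_mat(1))
qed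

subsection \<open>The quantum double as an instance\<close>

locale hecke_power = hecke_data +
  fixes k :: nat
  assumes k: "2 \<le> k"
begin

definition h :: complex where "h = q - inverse q"

lemma h_nonzero: "h \<noteq> 0"
proof
  assume "h = 0"
  moreover have q: "q \<noteq> 0" "q \<noteq> 1" "q \<noteq> -1"
    using hecke_symmetry by (auto simp: hecke_symmetry_def)
  ultimately have "q * q = 1" by (simp add: h_def field_simps)
  then show False using q by (metis square_eq_1_iff)
qed

text \<open>The Hecke relation expands to
  \<open>R * R - h \<cdot>\<^sub>m R = 1\<^sub>m (N ^ 2)\<close>, which exhibits the
  inverse.\<close>

lemma minv_R_eq: "minv R = R - h \<cdot>\<^sub>m 1\<^sub>m (N ^ 2)"
proof (rule minv_unique)
  let ?n = "N ^ 2"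
  have q: "q \<noteq> 0" and H: "(q \<cdot>\<^sub>m 1\<^sub>m ?n - R) * (inverse q \<cdot>\<^sub>m 1\<^sub>m ?n + R) = 0\<^sub>m ?n ?n"
    using hecke_symmetry by (auto simp: hecke_symmetry_def)
  have R: "R \<in> carrier_mat ?n ?n" by simp
  have 1: "(q \<cdot>\<^sub>m 1\<^sub>m ?n - R) * (inverse q \<cdot>\<^sub>m 1\<^sub>m ?n + R) =
      q \<cdot>\<^sub>m (inverse q \<cdot>\<^sub>m 1\<^sub>m ?n + R) - (inverse q \<cdot>\<^sub>m R + R * R)"
  proof -
    let ?Y = "inverse q \<cdot>\<^sub>m 1\<^sub>m ?n + R"
    have Y: "?Y \<in> carrier_mat ?n ?n" using R by simp
    have "(q \<cdot>\<^sub>m 1\<^sub>m ?n - R) * ?Y = q \<cdot>\<^sub>m 1\<^sub>m ?n * ?Y - R * ?Y"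
      using R Y by (intro minus_mult_distrib_mat[of _ ?n ?n _ _ ?n]) auto
    also have "q \<cdot>\<^sub>m 1\<^sub>m ?n * ?Y = q \<cdot>\<^sub>m (1\<^sub>m ?n * ?Y)"
      using Y by (intro mult_smult_assoc_mat[of _ ?n ?n _ ?n]) auto
    also have "1\<^sub>m ?n * ?Y = ?Y" using Y by (rule left_mult_one_mat)
    also have "R * ?Y = inverse q \<cdot>\<^sub>m R + R * R"
      using R by (simp add: mult_add_distrib_mat[of _ ?n ?n _ ?n] mult_smult_distrib[of _ ?n ?n _ ?n]
          right_mult_one_mat[OF R])
    finally show ?thesis .
  qed
  have 2: "R * (R - h \<cdot>\<^sub>m 1\<^sub>m ?n) = R * R - h \<cdot>\<^sub>m R"
    using R by (simp add: mult_minus_distrib_mat[of _ ?n ?n _ ?n] mult_smult_distrib[of _ ?n ?n _ ?n]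
        right_mult_one_mat[OF R])
  show "R * (R - h \<cdot>\<^sub>m 1\<^sub>m ?n) = 1\<^sub>m ?n"
  proof (rule eq_matI)
    fix i j assume "i < dim_row (1\<^sub>m ?n :: complex mat)" "j < dim_col (1\<^sub>m ?n :: complex mat)"
    then have ij: "i < ?n" "j < ?n" by simp_all
    define x y z where "x = R $$ (i, j)" and "y = (R * R) $$ (i, j)" and "z = (1\<^sub>m ?n :: complex mat) $$ (i, j)"
    have "(q \<cdot>\<^sub>m (inverse q \<cdot>\<^sub>m 1\<^sub>m ?n + R) - (inverse q \<cdot>\<^sub>m R + R * R)) $$ (i, j) = 0"
      using H ij unfolding 1 by simp
    then have "q * (inverse q * z + x) - (inverse q * x + y) = 0"
      unfolding x_def y_def z_def using R ij by (simp del: index_mult_mat(1) index_one_mat(1))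
    moreover have "q * (inverse q * z + x) = z + q * x" using q by (simp add: algebra_simps)
    ultimately have "y - h * x = z" by (simp add: h_def algebra_simps)
    then show "(R * (R - h \<cdot>\<^sub>m 1\<^sub>m ?n)) $$ (i, j) = 1\<^sub>m ?n $$ (i, j)"
      unfolding 2 x_def y_def z_def using carrier_matD[OF R] ij
      by (simp del: index_mult_mat(1) index_one_mat(1))
  qed (use carrier_matD[OF R] in auto)
qed (simp_all add: minus_carrier_mat)

abbreviation n :: nat where "n \<equiv> N ^ k"

abbreviation C :: "falg mat ring" where "C \<equiv> falg_mat_ring N n"

sublocale hom: ring_hom_ring C "Q n" "\<phi> n"
  by (rule \<phi>_hom)

definition \<psi> :: "complex mat \<Rightarrow> falg mat set" where
  "\<psi> A = \<phi> n (lift A)"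

lemma lift_C [simp]: "A \<in> carrier_mat n n \<Longrightarrow> lift A \<in> carrier C"
  by (simp add: closed_mat_lift)

lemma \<psi>_closed [simp]: "A \<in> carrier_mat n n \<Longrightarrow> \<psi> A \<in> carrier (Q n)"
  unfolding \<psi>_def by (intro hom.hom_closed lift_C)

lemma \<phi>_mult: "A \<in> carrier C \<Longrightarrow> B \<in> carrier C \<Longrightarrow> \<phi> n (A * B) = \<phi> n A \<otimes>\<^bsub>Q n\<^esub> \<phi> n B"
  using hom.hom_mult[of A B] by simp

lemma \<phi>_minus: "A \<in> carrier C \<Longrightarrow> B \<in> carrier C \<Longrightarrow> \<phi> n (A - B) = \<phi> n A \<ominus>\<^bsub>Q n\<^esub> \<phi> n B"
  unfolding minus_falg_mat[symmetric]
  by (simp only: a_minus_def hom.hom_add hom.hom_a_inv hom.R.a_inv_closed)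

lemma \<psi>_mult: "A \<in> carrier_mat n n \<Longrightarrow> B \<in> carrier_mat n n \<Longrightarrow> \<psi> (A * B) = \<psi> A \<otimes>\<^bsub>Q n\<^esub> \<psi> B"
  unfolding \<psi>_def by (simp only: lift_mult \<phi>_mult lift_C)

lemma \<psi>_one: "\<psi> (1\<^sub>m n) = \<one>\<^bsub>Q n\<^esub>"
  unfolding \<psi>_def lift_one using hom.hom_one by simp

lemma \<psi>_minus: "A \<in> carrier_mat n n \<Longrightarrow> B \<in> carrier_mat n n \<Longrightarrow> \<psi> (A - B) = \<psi> A \<ominus>\<^bsub>Q n\<^esub> \<psi> B"
  unfolding \<psi>_def by (simp only: lift_minus \<phi>_minus lift_C)

lemma minv_R_at: "1 \<le> i \<Longrightarrow> i < k \<Longrightarrow> minv (R_at N k R i) = R_at N k (minv R) i"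
  by (rule minv_unique[of _ n]) (simp_all add: R_at_mult minv_R R_at_one)

definition r :: "nat \<Rightarrow> falg mat set" where "r i = \<psi> (R_at N k R (Suc i))"
definition s :: "nat \<Rightarrow> falg mat set" where "s i = \<psi> (R_at N k (minv R) (Suc i))"
definition over :: "falg mat \<Rightarrow> nat \<Rightarrow> falg mat set" where "over X i = \<phi> n (overl N k R X (Suc i))"
definition c :: "falg mat set" where "c = \<psi> ((1 / h) \<cdot>\<^sub>m 1\<^sub>m n)"

lemma pow_k: "N * N ^ (k - 1) = n" "N ^ 2 * N ^ (k - 2) = n" "N ^ (k - 1) = N * N ^ (k - 2)"
  unfolding power_Suc[symmetric] power_add[symmetric] by (rule arg_cong[of _ _ "power N"], use k in simp)+

lemma kron_C:
  assumes "X \<in> carrier_mat N N" "closed_mat N X"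
  shows "kron X (1\<^sub>m (N ^ (k - 1))) \<in> carrier C"
proof -
  have "kron X (1\<^sub>m (N ^ (k - 1))) \<in> carrier_mat (N * N ^ (k - 1)) (N * N ^ (k - 1))"
    using assms(1) by (intro kron_carrier one_carrier_mat)
  then show ?thesis
    using closed_mat_kron_one[OF assms(2)] by (simp only: falg_mat_ring_simps pow_k(1) simp_thms)
qed

lemma overl_C:
  assumes "X \<in> carrier_mat N N" "closed_mat N X" "i < k"
  shows "overl N k R X (Suc i) \<in> carrier C"
  using assms(3)
proof (induction i)
  case 0
  then show ?case using kron_C[OF assms(1,2)] by simp
next
  case (Suc i)
  have "lift (R_at N k R (Suc i)) \<in> carrier C" "lift (R_at N k (minv R) (Suc i)) \<in> carrier C"
    using Suc.prems by (auto intro!: lift_C R_at_carrier simp: minv_R simp del: falg_mat_ring_simps(1))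
  then have "lift (R_at N k R (Suc i)) \<otimes>\<^bsub>C\<^esub> overl N k R X (Suc i) \<otimes>\<^bsub>C\<^esub> lift (R_at N k (minv R) (Suc i)) \<in> carrier C"
    using Suc by (intro hom.R.m_closed) auto
  then show ?case using Suc.prems by (simp add: minv_R_at)
qed

lemma r_mult: "i < k - 1 \<Longrightarrow> j < k - 1 \<Longrightarrow>
    r i \<otimes>\<^bsub>Q n\<^esub> r j = \<psi> (R_at N k R (Suc i) * R_at N k R (Suc j))"
  unfolding r_def by (simp add: \<psi>_mult)

lemma braid_rep: "braid_rep (Q n) (k - 1) r s"
proof
  show "r i \<in> carrier (Q n)" "s i \<in> carrier (Q n)" if "i < k - 1" for i
    unfolding r_def s_def using that by (simp_all add: minv_R)
  show "r i \<otimes>\<^bsub>Q n\<^esub> s i = \<one>\<^bsub>Q n\<^esub>" "s i \<otimes>\<^bsub>Q n\<^esub> r i = \<one>\<^bsub>Q n\<^esub>" if "i < k - 1" for i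
    unfolding r_def s_def using that
    by (simp_all add: minv_R R_at_mult R_at_one \<psi>_one flip: \<psi>_mult)
  show "r i \<otimes>\<^bsub>Q n\<^esub> r j = r j \<otimes>\<^bsub>Q n\<^esub> r i" if "Suc i < j" "j < k - 1" for i j
    using that R_at_far[of R N "Suc i" "Suc j" k] by (simp add: r_mult)
  show "r i \<otimes>\<^bsub>Q n\<^esub> r (Suc i) \<otimes>\<^bsub>Q n\<^esub> r i = r (Suc i) \<otimes>\<^bsub>Q n\<^esub> r i \<otimes>\<^bsub>Q n\<^esub> r (Suc i)"
    if i: "Suc i < k - 1" for i
  proof -
    let ?A = "kron R (1\<^sub>m N)" and ?B = "kron (1\<^sub>m N) R"
    \<comment> \<open>\<open>?F\<close> lets an operator on three factors act at positions
      \<open>i + 1\<close> to \<open>i + 3\<close>. It is multiplicative, so it carries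
      \<open>braid_eq\<close> to the two neighbouring generators.\<close>
    let ?F = "\<lambda>X. kron (1\<^sub>m (N ^ (Suc i - 1))) (kron X (1\<^sub>m (N ^ (k - Suc i - 2))))"
    have A: "?A \<in> carrier_mat (N ^ 3) (N ^ 3)" and B: "?B \<in> carrier_mat (N ^ 3) (N ^ 3)"
      using kron_carrier[OF R_carrier one_carrier_mat[of N]] kron_carrier[OF one_carrier_mat[of N] R_carrier]
      by (simp_all add: power2_eq_square power3_eq_cube mult.assoc)
    have F: "?F X * ?F Y = ?F (X * Y)" if "X \<in> carrier_mat (N ^ 3) (N ^ 3)" "Y \<in> carrier_mat (N ^ 3) (N ^ 3)" for X Y :: "complex mat"
      by (simp only: kron_one_mult[OF kron_carrier[OF that(1) one_carrier_mat] kron_carrier[OF that(2) one_carrier_mat]]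
          kron_mult_one[OF that])
    have a: "R_at N k R (Suc i) = ?F ?A" by (rule R_at_left) (use i in auto)
    have b: "R_at N k R (Suc (Suc i)) = ?F ?B" by (rule R_at_right) (use i in auto)
    have "?A * ?B * ?A = ?B * ?A * ?B"
      using hecke_symmetry by (simp add: hecke_symmetry_def braid_eq_def)
    then have "?F ?A * ?F ?B * ?F ?A = ?F ?B * ?F ?A * ?F ?B"
      using A B by (simp only: F mult_carrier_mat)
    moreover have "R_at N k R (Suc i) \<in> carrier_mat n n" "R_at N k R (Suc (Suc i)) \<in> carrier_mat n n"
      using i by simp_all
    ultimately show ?thesis
      unfolding r_def a[symmetric] b[symmetric]
      by (simp only: \<psi>_mult[symmetric] mult_carrier_mat)
  qed
qed


lemma overlined:
  assumes X: "X \<in> carrier_mat N N" "closed_mat N X"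
  shows "overlined (Q n) (k - 1) r s (over X)"
proof (intro overlined.intro braid_rep overlined_axioms.intro)
  show "over X 0 \<in> carrier (Q n)"
    unfolding over_def using overl_C[OF X, of 0] k by (intro hom.hom_closed) auto
  show "over X (Suc i) = r i \<otimes>\<^bsub>Q n\<^esub> over X i \<otimes>\<^bsub>Q n\<^esub> s i" if "i < k - 1" for i
  proof -
    have c: "lift (R_at N k R (Suc i)) \<in> carrier C" "lift (R_at N k (minv R) (Suc i)) \<in> carrier C"
      "overl N k R X (Suc i) \<in> carrier C"
      using that by (auto intro!: lift_C overl_C X R_at_carrier simp: minv_R simp del: falg_mat_ring_simps(1))
    have "lift (R_at N k R (Suc i)) * overl N k R X (Suc i) \<in> carrier C"
      using hom.R.m_closed[OF c(1,3)] by (simp only: falg_mat_ring_simps(2))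
    with c show ?thesis
      unfolding over_def r_def s_def \<psi>_def using that by (simp only: overl.simps) (simp add: minv_R_at \<phi>_mult del: falg_mat_ring_simps(1))
  qed
  show "r i \<otimes>\<^bsub>Q n\<^esub> over X 0 = over X 0 \<otimes>\<^bsub>Q n\<^esub> r i" if i: "0 < i" "i < k - 1" for i
  proof -
    \<comment> \<open>For \<open>0 < i\<close> the generator is the identity on the first factor,
      where \<open>X\<close> acts; the entries of \<open>lift W\<close> are scalars and commute with
      those of \<open>X\<close>.\<close>
    obtain W where W: "W \<in> carrier_mat (N ^ (k - 1)) (N ^ (k - 1))" "R_at N k R (Suc i) = kron (1\<^sub>m (N ^ 1)) W"
      by (rule R_at_split[OF R_carrier, of 1 "Suc i" k]) (use i in auto)
    have "lift (R_at N k R (Suc i)) = kron (1\<^sub>m N) (lift W)"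
      unfolding W(2) lift_kron by (simp add: lift_one)
    then have "lift (R_at N k R (Suc i)) * overl N k R X (Suc 0) = overl N k R X (Suc 0) * lift (R_at N k R (Suc i))"
      using kron_interchange[OF X(1), of "lift W" "N ^ (k - 1)"] W(1) by (simp add: scalar_central)
    moreover have "lift (R_at N k R (Suc i)) \<in> carrier C"
      using i by (intro lift_C R_at_carrier) auto
    moreover have "overl N k R X (Suc 0) \<in> carrier C"
      using k by (intro overl_C X) simp
    ultimately show ?thesis
      unfolding over_def r_def \<psi>_def by (metis \<phi>_mult)
  qed
qed

section \<open>Transport of the defining relations to k tensor factors\<close>

definition embed :: "falg mat \<Rightarrow> falg mat set" where
  "embed X = \<phi> n (kron X (1\<^sub>m (N ^ (k - 2))))"

abbreviation C2 :: "falg mat ring" where "C2 \<equiv> falg_mat_ring N (N ^ 2)"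

lemma kron_C2: "X \<in> carrier C2 \<Longrightarrow> kron X (1\<^sub>m (N ^ (k - 2))) \<in> carrier C"
proof -
  assume X: "X \<in> carrier C2"
  then have "kron X (1\<^sub>m (N ^ (k - 2))) \<in> carrier_mat (N ^ 2 * N ^ (k - 2)) (N ^ 2 * N ^ (k - 2))"
    by (intro kron_carrier one_carrier_mat) simp
  then show ?thesis
    using X by (simp only: falg_mat_ring_simps pow_k(2) closed_mat_kron_one simp_thms)
qed

lemma embed_mult:
  assumes "X \<in> carrier C2" "Y \<in> carrier C2"
  shows "embed (X * Y) = embed X \<otimes>\<^bsub>Q n\<^esub> embed Y"
  unfolding embed_def \<phi>_mult[OF kron_C2[OF assms(1)] kron_C2[OF assms(2)], symmetric]
  using assms by (subst kron_mult_one[of _ "N ^ 2"]) auto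

lemma embed_add:
  assumes "X \<in> carrier C2" "Y \<in> carrier C2"
  shows "embed (X + Y) = embed X \<oplus>\<^bsub>Q n\<^esub> embed Y"
proof -
  have "kron (X + Y) (1\<^sub>m (N ^ (k - 2))) = kron X (1\<^sub>m (N ^ (k - 2))) + kron Y (1\<^sub>m (N ^ (k - 2)))"
    using assms by (intro kron_plus_left[of _ "N ^ 2" "N ^ 2"]) auto
  then show ?thesis
    unfolding embed_def using hom.hom_add[OF kron_C2[OF assms(1)] kron_C2[OF assms(2)]]
    by (simp only: falg_mat_ring_simps(3))
qed

text \<open>Adjoining identity factors multiplies the entries of \<open>A - B\<close> by 0 or 1, so
  they stay in the ideal generated by the relations.\<close>

lemma embed_eq:
  assumes A: "A \<in> carrier C2" and B: "B \<in> carrier C2"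
    and rel: "elements_mat (A - B) \<subseteq> qd_relations N R"
  shows "embed A = embed B"
proof -
  let ?e = "N ^ (k - 2)"
  have c: "A - B \<in> carrier_mat (N ^ 2) (N ^ 2)" using A B by (simp add: minus_carrier_mat)
  have "kron (A - B) (1\<^sub>m ?e) \<in> ideal_mats N R n"
    unfolding ideal_mats_iff
  proof (intro conjI allI impI)
    show "kron (A - B) (1\<^sub>m ?e) \<in> carrier_mat n n"
      using kron_carrier[OF c one_carrier_mat[of ?e]] by (simp only: pow_k(2))
    fix i j assume "i < n" "j < n"
    then have ij: "i < N ^ 2 * ?e" "j < N ^ 2 * ?e" by (simp_all only: pow_k(2))
    note b = div_mod_less[OF ij(1)] div_mod_less[OF ij(2)]
    have "(A - B) $$ (i div ?e, j div ?e) \<in> qd_ideal N R"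
      using elements_matI[OF c b(1) b(3) refl] rel relations_in_ideal by blast
    moreover have "(1\<^sub>m ?e $$ (i mod ?e, j mod ?e) :: falg) \<in> carrier (free_alg N)"
      using b free_alg_closed(1,2) by (simp del: free_alg_simps)
    ultimately show "kron (A - B) (1\<^sub>m ?e) $$ (i, j) \<in> qd_ideal N R"
      unfolding kron_index[OF c one_carrier_mat ij] by (rule ideal_closed(4))
  qed
  moreover have "kron (A - B) (1\<^sub>m ?e) = kron A (1\<^sub>m ?e) - kron B (1\<^sub>m ?e)"
    using A B by (intro kron_minus_left[of _ "N ^ 2" "N ^ 2"]) auto
  ultimately show ?thesis
    unfolding embed_def \<phi>_eq_iff[OF kron_C2[OF A] kron_C2[OF B]] by (simp only:)
qed

lemma embed_lift:
  assumes "X \<in> carrier_mat (N ^ 2) (N ^ 2)"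
  shows "embed (lift X) = \<psi> (R_at N k X (Suc 0))"
proof -
  have "kron (1\<^sub>m (N ^ 0)) Y = Y" for Y :: "complex mat"
    using kron_one_left[of Y] by simp
  then have "R_at N k X (Suc 0) = kron X (1\<^sub>m (N ^ (k - 2)))"
    by (simp add: R_at_def numeral_2_eq_2)
  then show ?thesis
    by (simp only: embed_def \<psi>_def lift_kron lift_one)
qed

lemma embed_over: "embed (kron X (1\<^sub>m N)) = over X 0"
  unfolding embed_def over_def kron_assoc kron_one_one pow_k(3)[symmetric] overl.simps ..

lemma kron_one_C2:
  assumes "X \<in> carrier_mat N N" "closed_mat N X"
  shows "kron X (1\<^sub>m N) \<in> carrier C2"
  using kron_carrier[OF assms(1) one_carrier_mat[of N]] closed_mat_kron_one[OF assms(2)]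
  by (simp add: power2_eq_square)

lemma embed_gens:
  "embed (lift R) = r 0" "embed (lift (minv R)) = s 0"
  "embed (kron (Mmat N) (1\<^sub>m N)) = over (Mmat N) 0"
  "embed (kron (Dmat N) (1\<^sub>m N)) = over (Dmat N) 0"
  by (simp_all only: embed_lift R_carrier minv_R r_def s_def embed_over)

lemma gens_C2:
  "lift R \<in> carrier C2" "lift (minv R) \<in> carrier C2"
  "kron (Mmat N) (1\<^sub>m N) \<in> carrier C2" "kron (Dmat N) (1\<^sub>m N) \<in> carrier C2"
  using minv_R R_carrier
  by (auto intro!: kron_one_C2 gens_carrier closed_mat_gens simp: closed_mat_lift simp del: falg_mat_ring_simps(1))
    (simp_all add: closed_mat_lift)

lemma C2_mult: "X \<in> carrier C2 \<Longrightarrow> Y \<in> carrier C2 \<Longrightarrow> X * Y \<in> carrier C2"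
  and C2_add: "X \<in> carrier C2 \<Longrightarrow> Y \<in> carrier C2 \<Longrightarrow> X + Y \<in> carrier C2"
  using ring.ring_simprules(1,5)[OF ring_falg_mat_ring[of N "N ^ 2"], of X Y]
  by (simp_all only: falg_mat_ring_simps(2,3))

lemma D_relation:
  "s 0 \<otimes>\<^bsub>Q n\<^esub> over (Dmat N) 0 \<otimes>\<^bsub>Q n\<^esub> s 0 \<otimes>\<^bsub>Q n\<^esub> over (Dmat N) 0 =
   over (Dmat N) 0 \<otimes>\<^bsub>Q n\<^esub> s 0 \<otimes>\<^bsub>Q n\<^esub> over (Dmat N) 0 \<otimes>\<^bsub>Q n\<^esub> s 0"
proof -
  let ?D = "kron (Dmat N) (1\<^sub>m N)" and ?S = "lift (minv R)"
  have "embed (?S * ?D * ?S * ?D) = embed (?D * ?S * ?D * ?S)"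
  proof (rule embed_eq)
    show "elements_mat (?S * ?D * ?S * ?D - ?D * ?S * ?D * ?S) \<subseteq> qd_relations N R"
      unfolding qd_relations_def D_relations_def Let_def by blast
  qed (intro C2_mult gens_C2)+
  then show ?thesis
    by (simp only: embed_mult C2_mult gens_C2 embed_gens)
qed

lemma DM_relation:
  "over (Dmat N) 0 \<otimes>\<^bsub>Q n\<^esub> r 0 \<otimes>\<^bsub>Q n\<^esub> over (Mmat N) 0 \<otimes>\<^bsub>Q n\<^esub> r 0 =
   r 0 \<otimes>\<^bsub>Q n\<^esub> over (Mmat N) 0 \<otimes>\<^bsub>Q n\<^esub> s 0 \<otimes>\<^bsub>Q n\<^esub> over (Dmat N) 0 \<oplus>\<^bsub>Q n\<^esub> r 0"
proof -
  let ?D = "kron (Dmat N) (1\<^sub>m N)" and ?M = "kron (Mmat N) (1\<^sub>m N)" and ?R = "lift R" and ?S = "lift (minv R)"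
  have "embed (?D * ?R * ?M * ?R) = embed (?R * ?M * ?S * ?D + ?R)"
  proof (rule embed_eq)
    show "elements_mat (?D * ?R * ?M * ?R - (?R * ?M * ?S * ?D + ?R)) \<subseteq> qd_relations N R"
      unfolding qd_relations_def DM_relations_def Let_def by blast
  qed (intro C2_mult C2_add gens_C2)+
  then show ?thesis
    by (simp only: embed_mult embed_add C2_mult gens_C2 embed_gens)
qed

lemma scalar_one_commute:
  assumes "A \<in> carrier_mat n n"
  shows "(a \<cdot>\<^sub>m 1\<^sub>m n) * A = a \<cdot>\<^sub>m A" "A * (a \<cdot>\<^sub>m 1\<^sub>m n) = a \<cdot>\<^sub>m (A :: complex mat)"
  using assms mult_smult_assoc_mat[of "1\<^sub>m n" n n A n a] mult_smult_distrib[of A n n "1\<^sub>m n" n a] by simp_all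

text \<open>\<open>R_at\<close> is linear in its matrix argument, so \<open>minv_R_eq\<close>
  carries over; the check is made on entries.\<close>

lemma R_at_diff:
  assumes "1 \<le> i" "i < k"
  shows "R_at N k R i - R_at N k (minv R) i = h \<cdot>\<^sub>m 1\<^sub>m n"
proof -
  define e where "e = N ^ (k - i - 1)"
  have pow: "N ^ (i - 1) * (N ^ 2 * e) = n" unfolding e_def by (rule pow_split[OF assms])
  \<comment> \<open>The digits of an index belonging to the first \<open>i - 1\<close> factors, to
    the two factors on which the operator acts, and to the remaining ones.\<close>
  let ?l = "\<lambda>a. a div (N ^ 2 * e)" and ?m = "\<lambda>a. a mod (N ^ 2 * e) div e" and ?r = "\<lambda>a. a mod (N ^ 2 * e) mod e"
  have index: "R_at N k X i $$ (a, b) =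
      (1\<^sub>m (N ^ (i - 1)) :: complex mat) $$ (?l a, ?l b) * (X $$ (?m a, ?m b) * (1\<^sub>m e :: complex mat) $$ (?r a, ?r b))"
    and less: "?m a < N ^ 2" "?m b < N ^ 2"
    if X: "X \<in> carrier_mat (N ^ 2) (N ^ 2)" and ab: "a < n" "b < n" for a b and X :: "complex mat"
  proof -
    note ab' = ab[folded pow]
    note mods = div_mod_less(2)[OF ab'(1)] div_mod_less(2)[OF ab'(2)]
    show "?m a < N ^ 2" "?m b < N ^ 2"
      using div_mod_less(1)[OF mods(1)] div_mod_less(1)[OF mods(2)] by auto
    show "R_at N k X i $$ (a, b) =
      (1\<^sub>m (N ^ (i - 1)) :: complex mat) $$ (?l a, ?l b) * (X $$ (?m a, ?m b) * (1\<^sub>m e :: complex mat) $$ (?r a, ?r b))"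
      unfolding R_at_def e_def[symmetric] kron_index[OF one_carrier_mat kron_carrier[OF X one_carrier_mat] ab']
        kron_index[OF X one_carrier_mat mods] ..
  qed
  have c: "R_at N k R i \<in> carrier_mat n n" "R_at N k (minv R) i \<in> carrier_mat n n"
    using assms minv_R by simp_all
  show ?thesis
  proof (rule eq_matI)
    fix a b assume "a < dim_row (h \<cdot>\<^sub>m 1\<^sub>m n)" "b < dim_col (h \<cdot>\<^sub>m 1\<^sub>m n)"
    then have ab: "a < n" "b < n" by simp_all
    note m = less[OF R_carrier ab]
    have S: "minv R $$ (?m a, ?m b) = R $$ (?m a, ?m b) - h * (1\<^sub>m (N ^ 2) :: complex mat) $$ (?m a, ?m b)"
      unfolding minv_R_eq using m R_carrier by (simp del: index_one_mat(1))
    have "(R_at N k R i - R_at N k (minv R) i) $$ (a, b) = R_at N k R i $$ (a, b) - R_at N k (minv R) i $$ (a, b)"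
      using c ab by simp
    also have "\<dots> = h * R_at N k (1\<^sub>m (N ^ 2)) i $$ (a, b)"
      unfolding index[OF R_carrier ab] index[OF minv_R(1) ab] index[OF one_carrier_mat ab] S
      by (simp add: algebra_simps)
    also have "\<dots> = (h \<cdot>\<^sub>m 1\<^sub>m n) $$ (a, b)"
      using ab by (simp add: R_at_one[OF assms])
    finally show "(R_at N k R i - R_at N k (minv R) i) $$ (a, b) = (h \<cdot>\<^sub>m 1\<^sub>m n) $$ (a, b)" .
  qed (use c in auto)
qed

text \<open>\<open>dd_0\<close> is the relation for D multiplied by \<open>r 0\<close> on both
  sides. \<open>dm_0\<close> is the permutation relation multiplied on the right by
  \<open>s 0 \<otimes> s 0\<close>, which turns its left side into D times the second overlined copy
  of M. The axiom \<open>hecke\<close> is \<open>R_at_diff\<close> divided by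
  \<open>h\<close>.\<close>

lemma braided_double:
  "braided_double (Q n) (k - 1) r s (over (Mmat N)) (over (Dmat N)) c"
proof (intro braided_double.intro braided_double_axioms.intro overlined braid_rep gens_carrier closed_mat_gens)
  interpret braid_rep "Q n" "k - 1" r s by (rule braid_rep)
  interpret m: overlined "Q n" "k - 1" r s "over (Mmat N)"
    by (intro overlined gens_carrier closed_mat_gens)
  interpret d: overlined "Q n" "k - 1" r s "over (Dmat N)"
    by (intro overlined gens_carrier closed_mat_gens)
  let ?d = "over (Dmat N) 0" and ?m = "over (Mmat N) 0"
  have k': "0 < k - 1" using k by simp
  have [simp]: "?d \<in> carrier (Q n)" "?m \<in> carrier (Q n)" "r 0 \<in> carrier (Q n)" "s 0 \<in> carrier (Q n)"
    using k' by simp_all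
  have "?d \<otimes>\<^bsub>Q n\<^esub> s 0 \<otimes>\<^bsub>Q n\<^esub> ?d \<otimes>\<^bsub>Q n\<^esub> r 0 =
      r 0 \<otimes>\<^bsub>Q n\<^esub> (s 0 \<otimes>\<^bsub>Q n\<^esub> ?d \<otimes>\<^bsub>Q n\<^esub> s 0 \<otimes>\<^bsub>Q n\<^esub> ?d) \<otimes>\<^bsub>Q n\<^esub> r 0"
    using k' by (simp add: hom.S.m_assoc)
  also have "\<dots> = r 0 \<otimes>\<^bsub>Q n\<^esub> ?d \<otimes>\<^bsub>Q n\<^esub> s 0 \<otimes>\<^bsub>Q n\<^esub> ?d"
    unfolding D_relation using k' by (simp add: hom.S.m_assoc)
  finally show "?d \<otimes>\<^bsub>Q n\<^esub> s 0 \<otimes>\<^bsub>Q n\<^esub> ?d \<otimes>\<^bsub>Q n\<^esub> r 0 =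
      r 0 \<otimes>\<^bsub>Q n\<^esub> ?d \<otimes>\<^bsub>Q n\<^esub> s 0 \<otimes>\<^bsub>Q n\<^esub> ?d" .
  have m1: "over (Mmat N) 1 = r 0 \<otimes>\<^bsub>Q n\<^esub> ?m \<otimes>\<^bsub>Q n\<^esub> s 0"
    using m.x_Suc[OF k'] by simp
  have "?d \<otimes>\<^bsub>Q n\<^esub> over (Mmat N) 1 =
      (?d \<otimes>\<^bsub>Q n\<^esub> r 0 \<otimes>\<^bsub>Q n\<^esub> ?m \<otimes>\<^bsub>Q n\<^esub> r 0) \<otimes>\<^bsub>Q n\<^esub> s 0 \<otimes>\<^bsub>Q n\<^esub> s 0"
    unfolding m1 using k' by (simp add: hom.S.m_assoc)
  also have "\<dots> = over (Mmat N) 1 \<otimes>\<^bsub>Q n\<^esub> ?d \<otimes>\<^bsub>Q n\<^esub> s 0 \<otimes>\<^bsub>Q n\<^esub> s 0 \<oplus>\<^bsub>Q n\<^esub> s 0"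
    unfolding DM_relation m1 using k' by (simp add: hom.S.m_assoc hom.S.l_distr)
  finally show "?d \<otimes>\<^bsub>Q n\<^esub> over (Mmat N) 1 =
      over (Mmat N) 1 \<otimes>\<^bsub>Q n\<^esub> ?d \<otimes>\<^bsub>Q n\<^esub> s 0 \<otimes>\<^bsub>Q n\<^esub> s 0 \<oplus>\<^bsub>Q n\<^esub> s 0" .
  have c: "(1 / h) \<cdot>\<^sub>m 1\<^sub>m n \<in> carrier_mat n n" by simp
  then show "c \<in> carrier (Q n)" unfolding c_def by (rule \<psi>_closed)
  show "c \<otimes>\<^bsub>Q n\<^esub> r i = r i \<otimes>\<^bsub>Q n\<^esub> c" if "i < k - 1" for i
    unfolding c_def r_def using that c
    by (simp only: \<psi>_mult[symmetric] scalar_one_commute R_at_carrier[OF R_carrier])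
  show "c \<otimes>\<^bsub>Q n\<^esub> (r i \<ominus>\<^bsub>Q n\<^esub> s i) = \<one>\<^bsub>Q n\<^esub>" if i: "i < k - 1" for i
  proof -
    have R: "R_at N k R (Suc i) \<in> carrier_mat n n" "R_at N k (minv R) (Suc i) \<in> carrier_mat n n"
      using i minv_R by simp_all
    have "r i \<ominus>\<^bsub>Q n\<^esub> s i = \<psi> (h \<cdot>\<^sub>m 1\<^sub>m n)"
      unfolding r_def s_def \<psi>_minus[OF R, symmetric] using i by (simp add: R_at_diff)
    then have "c \<otimes>\<^bsub>Q n\<^esub> (r i \<ominus>\<^bsub>Q n\<^esub> s i) = \<psi> ((1 / h) \<cdot>\<^sub>m (h \<cdot>\<^sub>m 1\<^sub>m n))"
      unfolding c_def using c
      by (simp only: \<psi>_mult[symmetric] smult_carrier_mat one_carrier_mat scalar_one_commute(1))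
    also have "(1 / h) \<cdot>\<^sub>m (h \<cdot>\<^sub>m 1\<^sub>m n) = 1\<^sub>m n"
      using h_nonzero by (intro eq_matI) auto
    finally show ?thesis by (simp only: \<psi>_one)
  qed
qed

section \<open>Images of the two sides of the identity in the quotient\<close>

sublocale braided_double "Q n" "k - 1" r s "over (Mmat N)" "over (Dmat N)" c
  by (rule braided_double)


text \<open>One induction carries all four claims, because \<open>minv\<close> is junk until
  invertibility is known. The inverse of \<open>A * J * A\<close> is \<open>S * T * S\<close>, which
  is the recursion of \<open>jinv\<close>.\<close>

lemma jm_inverse:
  assumes "i < k"
  shows "jm N k R (Suc i) \<in> carrier_mat n n" "minv (jm N k R (Suc i)) \<in> carrier_mat n n"
    and "jm N k R (Suc i) * minv (jm N k R (Suc i)) = 1\<^sub>m n"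
    and "\<psi> (minv (jm N k R (Suc i))) = jinv i"
proof -
  have "jm N k R (Suc i) \<in> carrier_mat n n \<and> minv (jm N k R (Suc i)) \<in> carrier_mat n n \<and>
      jm N k R (Suc i) * minv (jm N k R (Suc i)) = 1\<^sub>m n \<and> \<psi> (minv (jm N k R (Suc i))) = jinv i"
    using assms
  proof (induction i)
    case 0
    have "minv (1\<^sub>m n) = 1\<^sub>m n" by (rule minv_unique) auto
    then show ?case by (simp add: \<psi>_one)
  next
    case (Suc i)
    define A S J T where "A = R_at N k R (Suc i)" and "S = R_at N k (minv R) (Suc i)"
      and "J = jm N k R (Suc i)" and "T = minv J"
    have c: "A \<in> carrier_mat n n" "S \<in> carrier_mat n n"
      unfolding A_def S_def using Suc.prems minv_R by simp_all
    have AS: "A * S = 1\<^sub>m n"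
      unfolding A_def S_def using Suc.prems by (simp add: R_at_mult minv_R R_at_one)
    have IH: "J \<in> carrier_mat n n" "T \<in> carrier_mat n n" "J * T = 1\<^sub>m n" "\<psi> T = jinv i"
      using Suc unfolding J_def T_def by auto
    have jm: "jm N k R (Suc (Suc i)) = A * J * A"
      unfolding A_def J_def by simp
    have "A * J * A * (S * T * S) = A * (J * (A * S * T)) * S"
      using c IH by (simp add: assoc_mult_mat[of _ n n _ n _ n])
    also have "\<dots> = 1\<^sub>m n"
      by (simp only: AS left_mult_one_mat[OF IH(2)] IH(3) right_mult_one_mat[OF c(1)])
    finally have 1: "A * J * A * (S * T * S) = 1\<^sub>m n" .
    have ST: "A * J * A \<in> carrier_mat n n" "S * T * S \<in> carrier_mat n n"
      using c IH by (auto intro!: mult_carrier_mat[of _ n n])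
    have inv: "minv (A * J * A) = S * T * S" by (rule minv_unique[OF ST 1])
    have "\<psi> (S * T * S) = s i \<otimes>\<^bsub>Q n\<^esub> jinv i \<otimes>\<^bsub>Q n\<^esub> s i"
      using c IH by (simp only: \<psi>_mult mult_carrier_mat s_def S_def[symmetric])
    then show ?case unfolding jm inv using ST 1 by simp
  qed
  then show "jm N k R (Suc i) \<in> carrier_mat n n" "minv (jm N k R (Suc i)) \<in> carrier_mat n n"
    "jm N k R (Suc i) * minv (jm N k R (Suc i)) = 1\<^sub>m n" "\<psi> (minv (jm N k R (Suc i))) = jinv i"
    by auto
qed

lemma jm_shift_p:
  assumes "i < k"
  shows "jm_shift N k q R (Suc i) \<in> carrier_mat n n" "\<psi> (jm_shift N k q R (Suc i)) = p i"
proof -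
  let ?T = "minv (jm N k R (Suc i))"
  have T: "?T \<in> carrier_mat n n" "1\<^sub>m n - ?T \<in> carrier_mat n n" "(1 / h) \<cdot>\<^sub>m 1\<^sub>m n \<in> carrier_mat n n"
    using jm_inverse(2)[OF assms] by (simp_all add: minus_carrier_mat)
  \<comment> \<open>\<open>\<phi> n\<close> is handled only as a ring homomorphism, so the scalar
    factor is written as a scalar matrix, whose image is \<open>c\<close>.\<close>
  have eq: "jm_shift N k q R (Suc i) = (1 / h) \<cdot>\<^sub>m 1\<^sub>m n * (1\<^sub>m n - ?T)"
    unfolding jm_shift_def h_def[symmetric] using T by (simp only: scalar_one_commute)
  show "jm_shift N k q R (Suc i) \<in> carrier_mat n n"
    unfolding eq using T by (intro mult_carrier_mat)
  show "\<psi> (jm_shift N k q R (Suc i)) = p i"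
    unfolding eq p_def using T
    by (simp only: \<psi>_mult \<psi>_minus one_carrier_mat \<psi>_one jm_inverse(4)[OF assms] c_def[symmetric])
qed

lemma \<phi>_one: "\<phi> n (1\<^sub>m n) = \<one>\<^bsub>Q n\<^esub>"
  using hom.hom_one by simp

lemma C_carrier_mat: "A \<in> carrier C \<Longrightarrow> A \<in> carrier_mat n n"
  by simp

lemma C_mult: "A \<in> carrier C \<Longrightarrow> B \<in> carrier C \<Longrightarrow> A * B \<in> carrier C"
  using hom.R.m_closed[of A B] by (simp only: falg_mat_ring_simps(2))

lemma C_minus: "A \<in> carrier C \<Longrightarrow> B \<in> carrier C \<Longrightarrow> A - B \<in> carrier C"
  using hom.R.minus_closed[of A B] by (simp only: minus_falg_mat)

lemma mprod_C: "(\<And>j. j \<in> set js \<Longrightarrow> F j \<in> carrier C) \<Longrightarrow> mprod n (map F js) \<in> carrier C"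
proof (induction js)
  case Nil
  then show ?case using hom.R.one_closed by simp
next
  case (Cons j js)
  then have "F j * mprod n (map F js) \<in> carrier C"
    by (intro C_mult Cons.IH) simp_all
  then show ?case by simp
qed

lemma \<phi>_mprod_append:
  assumes "\<And>j. j \<in> set js \<Longrightarrow> F j \<in> carrier C" "F i \<in> carrier C"
  shows "\<phi> n (mprod n (map F (js @ [i]))) = \<phi> n (mprod n (map F js)) \<otimes>\<^bsub>Q n\<^esub> \<phi> n (F i)"
proof -
  have "mprod n (map F (js @ [i])) = mprod n (map F js) * mprod n [F i]"
    unfolding map_append list.map
    by (rule mprod_append) (use assms in \<open>auto dest: C_carrier_mat\<close>)
  also have "mprod n [F i] = F i" using right_mult_one_mat[OF C_carrier_mat[OF assms(2)]] by simp
  finally show ?thesis using \<phi>_mult[OF mprod_C[OF assms(1)] assms(2)] by (simp only:)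
qed

lemma overl_C_from_1:
  assumes "X \<in> carrier_mat N N" "closed_mat N X" "1 \<le> j" "j \<le> k"
  shows "overl N k R X j \<in> carrier C"
  using overl_C[OF assms(1,2), of "j - 1"] assms(3,4) by (simp del: falg_mat_ring_simps(1))

lemma up_image: "i \<le> k \<Longrightarrow> \<phi> n (mprod n (map (overl N k R (Mmat N)) [1..<Suc i])) = up i"
proof (induction i)
  case 0
  then show ?case by (simp add: \<phi>_one)
next
  case (Suc i)
  have "[1..<Suc (Suc i)] = [1..<Suc i] @ [Suc i]" by simp
  moreover have "\<phi> n (mprod n (map (overl N k R (Mmat N)) ([1..<Suc i] @ [Suc i]))) =
      \<phi> n (mprod n (map (overl N k R (Mmat N)) [1..<Suc i])) \<otimes>\<^bsub>Q n\<^esub> \<phi> n (overl N k R (Mmat N) (Suc i))"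
    using Suc.prems by (intro \<phi>_mprod_append overl_C_from_1 gens_carrier closed_mat_gens) (simp_all del: upt_Suc)
  ultimately show ?case using Suc by (simp only: up.simps over_def[symmetric] Suc_leD)
qed

lemma down_image: "i \<le> k \<Longrightarrow> \<phi> n (mprod n (map (overl N k R (Dmat N)) (rev [1..<Suc i]))) = down i"
proof (induction i)
  case 0
  then show ?case by (simp add: \<phi>_one)
next
  case (Suc i)
  have "rev [1..<Suc (Suc i)] = Suc i # rev [1..<Suc i]" by simp
  moreover have "\<phi> n (overl N k R (Dmat N) (Suc i) * mprod n (map (overl N k R (Dmat N)) (rev [1..<Suc i]))) =
      \<phi> n (overl N k R (Dmat N) (Suc i)) \<otimes>\<^bsub>Q n\<^esub> \<phi> n (mprod n (map (overl N k R (Dmat N)) (rev [1..<Suc i])))"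
    using Suc.prems by (intro \<phi>_mult mprod_C overl_C_from_1 gens_carrier closed_mat_gens) (simp_all del: upt_Suc)
  ultimately show ?case using Suc by (simp only: down.simps over_def[symmetric] Suc_leD list.map mprod_Cons)
qed

lemma jm_C:
  assumes "1 \<le> j" "j \<le> k"
  shows "lift (minv (jm N k R j)) \<in> carrier C"
  using jm_inverse(2)[of "j - 1"] assms by (intro lift_C) simp

lemma lift_mprod:
  assumes "\<And>A. A \<in> set As \<Longrightarrow> A \<in> carrier_mat n n"
  shows "lift (mprod n As) = mprod n (map lift As)"
  using assms
proof (induction As)
  case Nil
  then show ?case by (simp add: lift_one)
next
  case (Cons A As)
  then have "A \<in> carrier_mat n n" "mprod n As \<in> carrier_mat n n" by (auto intro!: mprod_carrier)
  then show ?case using Cons by (simp add: lift_mult[of _ n n _ n])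
qed

lemma jinv_prod_image:
  "i \<le> k \<Longrightarrow> \<phi> n (mprod n (map (\<lambda>j. lift (minv (jm N k R j))) [1..<Suc i])) = jinv_prod i"
proof (induction i)
  case 0
  then show ?case by (simp add: \<phi>_one)
next
  case (Suc i)
  let ?F = "\<lambda>j. lift (minv (jm N k R j))"
  have "[1..<Suc (Suc i)] = [1..<Suc i] @ [Suc i]" by simp
  moreover have "\<phi> n (mprod n (map ?F ([1..<Suc i] @ [Suc i]))) =
      \<phi> n (mprod n (map ?F [1..<Suc i])) \<otimes>\<^bsub>Q n\<^esub> \<phi> n (?F (Suc i))"
    using Suc.prems by (intro \<phi>_mprod_append jm_C) (simp_all del: upt_Suc)
  moreover have "\<phi> n (?F (Suc i)) = jinv i"
    using jm_inverse(4)[of i] Suc.prems by (simp add: \<psi>_def)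
  ultimately show ?case using Suc by (simp only: jinv_prod.simps Suc_leD)
qed

lemma Lhat_closed: "Lhat N \<in> carrier_mat N N" "closed_mat N (Lhat N)"
  unfolding Lhat_def using gens_carrier[of N] closed_mat_gens[of N]
  by (auto intro!: mult_carrier_mat closed_mat_mult simp: carrier_matD)

text \<open>Each further copy is a conjugate of the previous one, and conjugation is multiplicative:
  the inner \<open>s i \<otimes> r i\<close> cancels.\<close>

lemma over_Lhat:
  "i < k \<Longrightarrow> over (Lhat N) i = over (Mmat N) i \<otimes>\<^bsub>Q n\<^esub> over (Dmat N) i"
proof (induction i)
  case 0
  have "overl N k R (Lhat N) (Suc 0) = overl N k R (Mmat N) (Suc 0) * overl N k R (Dmat N) (Suc 0)"
    unfolding Lhat_def overl.simps by (rule kron_mult_one[symmetric, OF gens_carrier])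
  moreover have "\<phi> n (overl N k R (Mmat N) (Suc 0) * overl N k R (Dmat N) (Suc 0)) =
      \<phi> n (overl N k R (Mmat N) (Suc 0)) \<otimes>\<^bsub>Q n\<^esub> \<phi> n (overl N k R (Dmat N) (Suc 0))"
    using 0 by (intro \<phi>_mult overl_C gens_carrier closed_mat_gens)
  ultimately show ?case by (simp only: over_def)
next
  case (Suc i)
  interpret L: overlined "Q n" "k - 1" r s "over (Lhat N)"
    by (intro overlined Lhat_closed)
  have i: "i < k - 1" using Suc.prems by simp
  then show ?case
    using Suc by (simp add: L.x_Suc m.x_Suc d.x_Suc hom.S.m_assoc)
qed

text \<open>The induction starts at 1, where the list is empty and, \<open>p 0\<close> being zero,
  \<open>capelli 1\<close> is the image of the unshifted first factor.\<close>

lemma capelli_image: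
  assumes "1 \<le> i" "i \<le> k"
  shows "\<phi> n (overl N k R (Lhat N) 1 *
      mprod n (map (\<lambda>r. overl N k R (Lhat N) r - lift (jm_shift N k q R r)) [2..<Suc i])) = capelli i"
  using assms
proof (induction i rule: dec_induct)
  case base
  have "overl N k R (Lhat N) 1 \<in> carrier C"
    using k by (intro overl_C_from_1 Lhat_closed) auto
  then have "\<phi> n (overl N k R (Lhat N) 1 * 1\<^sub>m n) = over (Lhat N) 0"
    using right_mult_one_mat[OF C_carrier_mat] by (simp add: over_def del: overl.simps falg_mat_ring_simps(1))
  also have "\<dots> = over (Mmat N) 0 \<otimes>\<^bsub>Q n\<^esub> over (Dmat N) 0"
    using k by (intro over_Lhat) simp
  also have "\<dots> = capelli 1"
  proof -
    have "over (Mmat N) 0 \<otimes>\<^bsub>Q n\<^esub> over (Dmat N) 0 \<in> carrier (Q n)" by simp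
    moreover have "p 0 = \<zero>\<^bsub>Q n\<^esub>"
      using hom.S.r_neg[OF hom.S.one_closed] by (simp add: p_def a_minus_def)
    ultimately show ?thesis
      by (simp add: a_minus_def hom.S.minus_zero)
  qed
  finally show ?case by simp
next
  case (step i)
  let ?F = "\<lambda>r. overl N k R (Lhat N) r - lift (jm_shift N k q R r)"
  have F: "?F j \<in> carrier C" if "1 \<le> j" "j \<le> k" for j
    using that jm_shift_p(1)[of "j - 1"] by (intro C_minus overl_C_from_1 Lhat_closed lift_C) auto
  have L: "overl N k R (Lhat N) 1 \<in> carrier C"
    using k by (intro overl_C_from_1 Lhat_closed) auto
  have P: "mprod n (map ?F [2..<Suc j]) \<in> carrier C" if "j \<le> k" for j
    using that by (intro mprod_C F) (auto simp del: upt_Suc)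
  have i: "i < k" using step.prems by simp
  let ?x = "over (Mmat N) i \<otimes>\<^bsub>Q n\<^esub> over (Dmat N) i \<ominus>\<^bsub>Q n\<^esub> p i"
    and ?L = "\<phi> n (overl N k R (Lhat N) 1)" and ?P = "\<lambda>i. mprod n (map ?F [2..<Suc i])"
  have eq: "[2..<Suc (Suc i)] = [2..<Suc i] @ [Suc i]" using step.hyps by simp
  have "\<phi> n (?F (Suc i)) = ?x"
    using \<phi>_minus[of "overl N k R (Lhat N) (Suc i)" "lift (jm_shift N k q R (Suc i))"]
      overl_C[OF Lhat_closed i] lift_C[OF jm_shift_p(1)[OF i]] jm_shift_p(2)[OF i] over_Lhat[OF i]
    by (simp only: over_def[symmetric] \<psi>_def)
  moreover have "\<phi> n (?P (Suc i)) = \<phi> n (?P i) \<otimes>\<^bsub>Q n\<^esub> \<phi> n (?F (Suc i))"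
    unfolding eq using i by (intro \<phi>_mprod_append F) (simp_all del: upt_Suc)
  ultimately have P_Suc: "\<phi> n (?P (Suc i)) = \<phi> n (?P i) \<otimes>\<^bsub>Q n\<^esub> ?x" by simp
  have closed: "?L \<in> carrier (Q n)" "\<phi> n (?P i) \<in> carrier (Q n)" "?x \<in> carrier (Q n)"
    using hom.hom_closed[OF L] hom.hom_closed[OF P[of i]] i by simp_all
  have IH: "?L \<otimes>\<^bsub>Q n\<^esub> \<phi> n (?P i) = capelli i"
    using step.IH i \<phi>_mult[OF L P[of i]] by simp
  have "\<phi> n (overl N k R (Lhat N) 1 * ?P (Suc i)) = ?L \<otimes>\<^bsub>Q n\<^esub> (\<phi> n (?P i) \<otimes>\<^bsub>Q n\<^esub> ?x)"
    using \<phi>_mult[OF L P[of "Suc i"]] i unfolding P_Suc by simp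
  also have "\<dots> = capelli i \<otimes>\<^bsub>Q n\<^esub> ?x"
    using hom.S.m_assoc[OF closed] IH by (simp only:)
  finally show ?case by (simp only: capelli.simps)
qed

theorem matrix_capelli:
  "map_mat (qd_proj N R)
     (overl N k R (Lhat N) 1 *
      mprod n (map (\<lambda>r. overl N k R (Lhat N) r - lift (jm_shift N k q R r)) [2..<Suc k])) =
   map_mat (qd_proj N R)
     (overl_up N k R (Mmat N) * overl_down N k R (Dmat N) *
      lift (mprod n (map (\<lambda>s. minv (jm N k R s)) [1..<Suc k])))"
proof -
  let ?F = "\<lambda>r. overl N k R (Lhat N) r - lift (jm_shift N k q R r)"
  let ?J = "mprod n (map (\<lambda>s. lift (minv (jm N k R s))) [1..<Suc k])"
  have F: "?F j \<in> carrier C" if "1 \<le> j" "j \<le> k" for j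
    using that jm_shift_p(1)[of "j - 1"] by (intro C_minus overl_C_from_1 Lhat_closed lift_C) auto
  have lhs: "overl N k R (Lhat N) 1 * mprod n (map ?F [2..<Suc k]) \<in> carrier C"
    using k by (intro C_mult mprod_C F overl_C_from_1 Lhat_closed) (auto simp del: upt_Suc)
  have U: "overl_up N k R (Mmat N) \<in> carrier C" and D: "overl_down N k R (Dmat N) \<in> carrier C"
    unfolding overl_up_def overl_down_def
    by (intro mprod_C overl_C_from_1 gens_carrier closed_mat_gens; simp del: upt_Suc)+
  have J: "?J \<in> carrier C"
    by (intro mprod_C jm_C) (simp_all del: upt_Suc)
  have "lift (mprod n (map (\<lambda>s. minv (jm N k R s)) [1..<Suc k])) =
      mprod n (map lift (map (\<lambda>s. minv (jm N k R s)) [1..<Suc k]))"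
  proof (rule lift_mprod)
    fix A assume "A \<in> set (map (\<lambda>s. minv (jm N k R s)) [1..<Suc k])"
    then obtain j where j: "A = minv (jm N k R j)" "1 \<le> j" "j \<le> k" by (auto simp del: upt_Suc)
    then show "A \<in> carrier_mat n n" using jm_inverse(2)[of "j - 1"] by simp
  qed
  then have J_eq: "lift (mprod n (map (\<lambda>s. minv (jm N k R s)) [1..<Suc k])) = ?J"
    by (simp only: map_map o_def)
  have "\<phi> n (overl N k R (Lhat N) 1 * mprod n (map ?F [2..<Suc k])) = capelli k"
    using k by (intro capelli_image) simp_all
  \<comment> \<open>\<open>capelli_identity\<close> is instantiated with \<open>k - 1\<close> braid
    generators, so its bound reads \<open>k \<le> Suc (k - 1)\<close>.\<close>
  also have "\<dots> = up k \<otimes>\<^bsub>Q n\<^esub> down k \<otimes>\<^bsub>Q n\<^esub> jinv_prod k"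
    by (rule capelli_identity) simp
  also have "\<dots> = \<phi> n (overl_up N k R (Mmat N) * overl_down N k R (Dmat N) * ?J)"
    using U D J by (simp only: \<phi>_mult C_mult overl_up_def overl_down_def
        up_image[OF order_refl] down_image[OF order_refl] jinv_prod_image[OF order_refl])
  finally show ?thesis
    unfolding \<phi>_eq_iff_qd_proj[OF lhs C_mult[OF C_mult[OF U D] J]] J_eq .
qed

end

theorem theorem21:
  fixes N k :: nat and q :: complex and R :: "complex mat"
  assumes "hecke_symmetry N q R" and "generic q" and "skew_invertible N R"
    and "in_deformation_family N q R"
    and "k \<ge> 2"
  shows "map_mat (qd_proj N R)
           (overl N k R (Lhat N) 1 *
            mprod (N ^ k) (map (\<lambda>r. overl N k R (Lhat N) r - lift (jm_shift N k q R r)) [2..<Suc k])) =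
         map_mat (qd_proj N R)
           (overl_up N k R (Mmat N) * overl_down N k R (Dmat N) *
            lift (mprod (N ^ k) (map (\<lambda>s. minv (jm N k R s)) [1..<Suc k])))"
proof -
  interpret hecke_power N q R k
    by unfold_locales (use assms in simp_all)
  show ?thesis by (rule matrix_capelli)
qed

end
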